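(* Let $\Gamma=D_3=\langle(1,2,3),(2,3)\rangle$ act on $\mathbb{R}^3$ by permuting the coordinates, let $$A=\frac14\begin{bmatrix}-4&-2&-2\\-2&-4&-2\\-2&-2&-4\end{bmatrix},$$ and let $m=3$. Let $f:\mathbb{R}\times\mathbb{R}^3\to\mathbb{R}^3$ be a continuous function such that for all $t\in\mathbb{R}$, $x\in\mathbb{R}^3$, $\sigma\in\Gamma$: $f(t+2\pi,x)=f(t,x)$, $f(-t,x)=f(t,x)$, $f(t,-x)=-f(t,x)$, $f(t,\sigma x)=\sigma f(t,x)$; such that $\lim_{x\to0}\frac{f(t,x)-Ax}{|x|}=0$ uniformly with respect to $t\in\mathbb{R}$; and such that there exists $M>0$ with $f(t,x)\bullet x>0$ for all $t\in\mathbb{R}$ and all $|x|\ge M$ (with $\bullet$ the Euclidean inner product). Then, for the system $\ddot u(t)=f(t,u(t))$, there exist: (i) at least one $(D_1\times_{\mathbb{Z}_2}^{D_3}D_3^p)$-orbit of (i.e. at least 6 different) $6\pi$-periodic solutions; (ii) at least one $(D_3\times D_3^z)$-orbit of (i.e. at least 2 different) $6\pi$-periodic solutions; (iii) at least one $(D_3\times D_3)$-orbit of (i.e. at least 2 different) $6\pi$-periodic solutions. Therefore, the system admits at least 10 different $6\pi$-periodic solutions.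
   Context: For $\sigma\in S_3$, $\sigma(x_1,x_2,x_3)^T=(x_{\sigma(1)},x_{\sigma(2)},x_{\sigma(3)})^T$. The eigenvalues of $A$ are $-2$ and $-\frac12$, so the non-degeneracy condition $\frac{j^2}{9}+\mu\ne0$ for all integers $j\ge0$ and $\mu\in\sigma(A)$ holds automatically. $G=\Gamma\times D_3\times\mathbb{Z}_2$ with $\Gamma=D_3$ (first factor, acting on coordinates), the second factor $D_3$ generated by $\gamma$ (of order 3) and the reflection $\kappa$, and $\mathbb{Z}_2=\{\pm1\}$. $G$ acts on the space of $6\pi$-periodic $C^2$ functions $u:\mathbb{R}\to\mathbb{R}^3$ by $((\sigma,\gamma^j,\pm1)u)(t)=\pm\sigma u(t+2\pi j)$ and $((\sigma,\kappa,\pm1)u)(t)=\pm\sigma u(-t)$. For a subgroup $H\le G$, an "$(H)$-orbit of solutions" is a $G$-orbit of a solution $u$ whose isotropy group $G_u=\{g\in G:gu=u\}$ is conjugate in $G$ to $H$. Subgroups: in $D_3\times\mathbb{Z}_2$ (second and third factors), $D_3^p=D_3\times\mathbb{Z}_2$, $D_3=D_3\times\{1\}$, and $D_3^z$ is the subgroup generated by $(\gamma,1)$ and $(\kappa,-1)$. In products $H\times K$ below, $H\le\Gamma$ and $K\le D_3\times\mathbb{Z}_2$: thus $D_3\times D_3^z=\Gamma\times D_3^z$ and $D_3\times D_3=\Gamma\times D_3\times\{1\}$. $D_1\le\Gamma$ is the subgroup of order 2 generated by a transposition $\tau$, and $D_1\times_{\mathbb{Z}_2}^{D_3}D_3^p=\{(a,b)\in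 D_1\times D_3^p:\varphi(a)=\psi(b)\}$, where $\varphi:D_1\to\mathbb{Z}_2$ is the isomorphism and $\psi:D_3^p\to\mathbb{Z}_2$ is the homomorphism with kernel $D_3$; explicitly it is $\{(1,g,1),(\tau,g,-1): g\in D_3\}$. *)

theory Defs
  imports
    "HOL-Analysis.Analysis"
    "HOL-Algebra.Group_Action"
    "HOL-Algebra.Generated_Groups"
begin

section \<open>The symmetry group\<close>

text \<open>
  The coordinates of \<^typ>\<open>real^3\<close> are indexed by the three-element type \<^typ>\<open>3\<close>, whose elements
  are \<open>1\<close>, \<open>2\<close> and \<open>3 = 0\<close>.
\<close>

definition perm_vec :: "(3 \<Rightarrow> 3) \<Rightarrow> real^3 \<Rightarrow> real^3" where
  "perm_vec \<sigma> x = (\<chi> i. x $ \<sigma> i)"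

text \<open>
  Products of permutations are read from left to right: with this convention the formula for
  \<^const>\<open>perm_vec\<close> is a left action.
\<close>

definition Perm3 :: "(3 \<Rightarrow> 3) monoid" where
  "Perm3 = \<lparr>carrier = {\<sigma>. bij \<sigma>}, mult = (\<lambda>\<sigma> \<tau>. \<tau> \<circ> \<sigma>), one = id\<rparr>"

text \<open>
  The dihedral group of order 6; the pair \<open>(j, r)\<close> stands for \<open>\<gamma>\<^sup>j\<kappa>\<close> if \<open>r\<close> holds, and for
  \<open>\<gamma>\<^sup>j\<close> otherwise.
\<close>

definition Dih3 :: "(int \<times> bool) monoid" where
  "Dih3 = \<lparr>carrier = {0..<3} \<times> UNIV,
     mult = (\<lambda>(j, r) (k, s). ((j + (if r then - k else k)) mod 3, r \<noteq> s)),
     one = (0, False)\<rparr>"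

definition dih_gamma :: "int \<times> bool" where "dih_gamma = (1, False)"

definition dih_kappa :: "int \<times> bool" where "dih_kappa = (0, True)"

definition Sgn :: "real monoid" where
  "Sgn = \<lparr>carrier = {1, -1}, mult = (*), one = 1\<rparr>"

type_synonym sym_elem = "(3 \<Rightarrow> 3) \<times> ((int \<times> bool) \<times> real)"

definition SymG :: "sym_elem monoid" where
  "SymG = Perm3 \<times>\<times> (Dih3 \<times>\<times> Sgn)"


section \<open>The action on periodic functions\<close>

definition C2_periodic :: "(real \<Rightarrow> real^3) set" where
  "C2_periodic = {u. (\<forall>t. u (t + 6 * pi) = u t) \<and>
     (\<exists>v. (\<forall>t. (u has_vector_derivative v t) (at t)) \<and> v C1_differentiable_on UNIV)}"

text \<open>
  Since \<open>(\<gamma>\<^sup>j u)(t) = u(t + 2\<pi>j)\<close> and \<open>(\<kappa> u)(t) = u(-t)\<close>, one has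
  \<open>(\<gamma>\<^sup>j \<kappa> u)(t) = (\<kappa> u)(t + 2\<pi>j) = u(-(t + 2\<pi>j))\<close>.
\<close>

fun time_map :: "int \<times> bool \<Rightarrow> real \<Rightarrow> real" where
  "time_map (j, r) t = (if r then - (t + 2 * pi * of_int j) else t + 2 * pi * of_int j)"

text \<open>Restricted to \<^const>\<open>C2_periodic\<close>, as required by \<^locale>\<open>group_action\<close>.\<close>

definition act :: "sym_elem \<Rightarrow> (real \<Rightarrow> real^3) \<Rightarrow> real \<Rightarrow> real^3" where
  "act = (\<lambda>(\<sigma>, d, s). \<lambda>u\<in>C2_periodic. \<lambda>t. s *\<^sub>R perm_vec \<sigma> (u (time_map d t)))"


section \<open>Subgroups\<close>

definition tau :: "3 \<Rightarrow> 3" where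
  "tau = Transposition.transpose 2 3"

text \<open>
  The fibre product of \<open>\<langle>tau\<rangle>\<close> and \<open>D\<^sub>3 \<times> {1, -1}\<close> over \<open>{1, -1}\<close>: the isomorphism
  \<open>\<langle>tau\<rangle> \<rightarrow> {1, -1}\<close> sends \<^const>\<open>id\<close> to \<open>1\<close>, and \<^const>\<open>snd\<close> is the homomorphism with kernel
  \<open>D\<^sub>3 \<times> {1}\<close>.
\<close>

definition H_D1_D3p :: "sym_elem set" where
  "H_D1_D3p = {(a, b). a \<in> generate Perm3 {tau} \<and> b \<in> carrier (Dih3 \<times>\<times> Sgn) \<and>
     (if a = id then 1 else -1) = snd b}"

definition D3z :: "((int \<times> bool) \<times> real) set" where
  "D3z = generate (Dih3 \<times>\<times> Sgn) {(dih_gamma, 1), (dih_kappa, -1)}"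

definition H_D3_D3z :: "sym_elem set" where
  "H_D3_D3z = carrier Perm3 \<times> D3z"

definition H_D3_D3 :: "sym_elem set" where
  "H_D3_D3 = carrier Perm3 \<times> (carrier Dih3 \<times> {1})"


section \<open>Solutions and their orbits\<close>

definition solutions :: "(real \<times> (real^3) \<Rightarrow> real^3) \<Rightarrow> (real \<Rightarrow> real^3) set" where
  "solutions f = {u \<in> C2_periodic. \<exists>v. \<forall>t. (u has_vector_derivative v t) (at t) \<and>
     (v has_vector_derivative f (t, u t)) (at t)}"

definition conjugate_in :: "('g, 'm) monoid_scheme \<Rightarrow> 'g set \<Rightarrow> 'g set \<Rightarrow> bool" where
  "conjugate_in G H K \<longleftrightarrow> (\<exists>g\<in>carrier G. K = g <#\<^bsub>G\<^esub> H #>\<^bsub>G\<^esub> inv\<^bsub>G\<^esub> g)"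

definition solution_orbits ::
  "sym_elem set \<Rightarrow> (real \<times> (real^3) \<Rightarrow> real^3) \<Rightarrow> (real \<Rightarrow> real^3) set set" where
  "solution_orbits H f =
     {orbit SymG act u | u. u \<in> solutions f \<and> conjugate_in SymG H (stabilizer SymG act u)}"

definition matA :: "real^3^3" where
  "matA = (1/4) *\<^sub>R vector [vector [-4, -2, -2], vector [-2, -4, -2], vector [-2, -2, -4]]"


section \<open>Adequacy of the encoding\<close>

lemma group_Perm3: "group Perm3"
proof (rule groupI)
  fix x assume "x \<in> carrier Perm3"
  then have "bij x" by (simp add: Perm3_def)
  then show "\<exists>y\<in>carrier Perm3. y \<otimes>\<^bsub>Perm3\<^esub> x = \<one>\<^bsub>Perm3\<^esub>"
    by (intro bexI[of _ "inv_into UNIV x"])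
      (auto simp: Perm3_def bij_imp_bij_inv fun_eq_iff bij_is_surj surj_f_inv_f)
qed (auto simp: Perm3_def bij_comp comp_assoc)

lemma carrier_Perm3_generated: "carrier Perm3 = generate Perm3 {\<lambda>i. i + 1, tau}"
proof
  let ?c = "\<lambda>i::3. i + 1" and ?s = tau
  let ?X = "generate Perm3 {?c, ?s}"
  have c: "?c \<in> ?X" and s: "?s \<in> ?X" and i: "id \<in> ?X"
    using generate.incl[of _ "{?c, ?s}" Perm3] generate.one[of Perm3 "{?c, ?s}"]
    by (auto simp: Perm3_def)
  have m: "q \<circ> p \<in> ?X" if "p \<in> ?X" "q \<in> ?X" for p q
    using generate.eng[OF that] by (simp add: Perm3_def)
  show "carrier Perm3 \<subseteq> ?X"
  proof
    fix p assume "p \<in> carrier Perm3"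
    then have "inj p" by (simp add: Perm3_def bij_is_inj)
    then have ne: "p 1 \<noteq> p 2" "p 1 \<noteq> p 3" "p 2 \<noteq> p 3"
      by (simp_all add: inj_eq)
    have vals: "?c 1 = 2" "?c 2 = 3" "?c 3 = 1" "?s 1 = 1" "?s 2 = 3" "?s 3 = 2"
      by (simp_all add: tau_def Transposition.transpose_def)
    have ext: "p = q" if "p 1 = q 1" "p 2 = q 2" "p 3 = q 3" for q
      using that by (simp add: fun_eq_iff forall_3)
    consider "p 1 = 1" "p 2 = 2" "p 3 = 3" | "p 1 = 1" "p 2 = 3" "p 3 = 2"
      | "p 1 = 2" "p 2 = 1" "p 3 = 3" | "p 1 = 2" "p 2 = 3" "p 3 = 1"
      | "p 1 = 3" "p 2 = 1" "p 3 = 2" | "p 1 = 3" "p 2 = 2" "p 3 = 1"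
      using exhaust_3[of "p 1"] exhaust_3[of "p 2"] exhaust_3[of "p 3"] ne by metis
    then have "p = id \<or> p = ?s \<or> p = ?c \<circ> ?s \<or> p = ?c \<or> p = ?c \<circ> ?c \<or> p = ?c \<circ> (?c \<circ> ?s)"
    proof cases
      case 1 then show ?thesis using ext[of id] by simp
    next
      case 2 then show ?thesis using ext[of ?s] vals by simp
    next
      case 3 then show ?thesis using ext[of "?c \<circ> ?s"] vals by simp
    next
      case 4 then show ?thesis using ext[of ?c] vals by simp
    next
      case 5 then show ?thesis using ext[of "?c \<circ> ?c"] vals by simp
    next
      case 6 then show ?thesis using ext[of "?c \<circ> (?c \<circ> ?s)"] vals by simp
    qed
    then show "p \<in> ?X"
      using m[OF c c] m[OF s c] m[OF m[OF s c] c] c s i by (elim disjE) simp_all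
  qed
  have "bij ?c" "bij tau" by (simp_all add: bij_plus_right tau_def)
  then show "?X \<subseteq> carrier Perm3"
    using group.generate_incl[OF group_Perm3, of "{?c, ?s}"] by (auto simp: Perm3_def)
qed

lemma group_Dih3: "group Dih3"
proof (rule groupI)
  fix x assume "x \<in> carrier Dih3"
  then obtain j r where x: "x = (j, r)" "0 \<le> j" "j < 3" by (auto simp: Dih3_def)
  show "\<exists>y\<in>carrier Dih3. y \<otimes>\<^bsub>Dih3\<^esub> x = \<one>\<^bsub>Dih3\<^esub>"
    by (rule bexI[of _ "(if r then j else (- j) mod 3, r)"])
      (use x in \<open>auto simp: Dih3_def mod_simps\<close>)
qed (auto simp: Dih3_def mod_simps algebra_simps)

lemma group_Sgn: "group Sgn"
  by (rule groupI) (auto simp: Sgn_def)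

lemma group_SymG: "group SymG"
  unfolding SymG_def by (intro DirProd_group group_Perm3 group_Dih3 group_Sgn)

lemma C2_periodic_shift:
  assumes u: "u \<in> C2_periodic"
  shows "u (t + 6 * pi * of_int k) = u t"
proof -
  have nat: "u (t + 6 * pi * of_nat n) = u t" for n :: nat and t
  proof (induction n)
    case (Suc n)
    have "u (t + 6 * pi * of_nat (Suc n)) = u ((t + 6 * pi * of_nat n) + 6 * pi)"
      by (simp add: algebra_simps)
    then show ?case using Suc u by (simp add: C2_periodic_def)
  qed simp
  show ?thesis
  proof (cases k rule: int_cases2)
    case (nonneg n)
    then show ?thesis using nat[of t n] by simp
  next
    case (nonpos n)
    then show ?thesis using nat[of "t - 6 * pi * of_nat n" n] by simp
  qed
qed

lemma bounded_linear_perm_vec: "bounded_linear (perm_vec \<sigma>)"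
  unfolding linear_conv_bounded_linear[symmetric]
  by (rule linearI) (auto simp: perm_vec_def vec_eq_iff)

lemma act_closed:
  assumes u: "u \<in> C2_periodic" and g: "g \<in> carrier SymG"
  shows "act g u \<in> C2_periodic"
proof -
  obtain \<sigma> j r s where g_eq: "g = (\<sigma>, (j, r), s)" by (metis prod.exhaust)
  define e where "e = (if r then - 1 else 1 :: real)"
  define a where "a = e * (2 * pi * of_int j)"
  have tm: "time_map (j, r) t = e * t + a" for t
    by (simp add: e_def a_def)
  define L where "L = (\<lambda>x. s *\<^sub>R perm_vec \<sigma> x)"
  have L: "bounded_linear L"
    unfolding L_def by (rule bounded_linear_const_scaleR[OF bounded_linear_perm_vec])
  have au: "act g u = (\<lambda>t. L (u (e * t + a)))"
    using u unfolding g_eq act_def L_def by (simp only: prod.case restrict_apply' tm)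
  have e6: "u (e * (t + 6 * pi) + a) = u (e * t + a)" for t
    using C2_periodic_shift[OF u, of "e * t + a" 1] C2_periodic_shift[OF u, of "e * t + a" "-1"]
    by (auto simp: e_def algebra_simps)
  obtain v where v: "\<And>t. (u has_vector_derivative v t) (at t)" "v C1_differentiable_on UNIV"
    using u by (auto simp: C2_periodic_def)
  obtain w where w: "\<And>t. (v has_vector_derivative w t) (at t)" "continuous_on UNIV w"
    using v(2) by (auto simp: C1_differentiable_on_def)
  have chain: "((\<lambda>t. L (h (e * t + a))) has_vector_derivative e *\<^sub>R L (h' (e * t + a))) (at t)"
    if h: "\<And>t. (h has_vector_derivative h' t) (at t)" for h h' :: "real \<Rightarrow> real^3" and t
  proof -
    have "((\<lambda>t. e * t + a) has_vector_derivative e) (at t)"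
      by (auto intro!: derivative_eq_intros simp: has_real_derivative_iff_has_vector_derivative[symmetric])
    then have "(h \<circ> (\<lambda>t. e * t + a) has_vector_derivative e *\<^sub>R h' (e * t + a)) (at t)"
      using h by (rule vector_diff_chain_at)
    then have "((\<lambda>t. L ((h \<circ> (\<lambda>t. e * t + a)) t)) has_vector_derivative L (e *\<^sub>R h' (e * t + a))) (at t)"
      by (rule bounded_linear.has_vector_derivative[OF L])
    then show ?thesis
      by (simp add: linear_scale[OF bounded_linear.linear[OF L]])
  qed
  define v' where "v' = (\<lambda>t. e *\<^sub>R L (v (e * t + a)))"
  have "(v' has_vector_derivative e *\<^sub>R (e *\<^sub>R L (w (e * t + a)))) (at t)" for t
    unfolding v'_def
    by (rule bounded_linear.has_vector_derivative[OF bounded_linear_scaleR_right chain[OF w(1)]])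
  moreover have "continuous_on UNIV (\<lambda>t. e *\<^sub>R (e *\<^sub>R L (w (e * t + a))))"
    by (intro continuous_intros bounded_linear.continuous_on[OF L]
        continuous_on_compose2[OF w(2)]) auto
  ultimately have "v' C1_differentiable_on UNIV"
    unfolding C1_differentiable_on_def by (auto intro!: exI)
  moreover have "(act g u has_vector_derivative v' t) (at t)" for t
    unfolding au v'_def by (rule chain[OF v(1)])
  moreover have "act g u (t + 6 * pi) = act g u t" for t
    by (simp only: au e6)
  ultimately show ?thesis unfolding C2_periodic_def by blast
qed

lemma act_mult:
  assumes u: "u \<in> C2_periodic" and g: "g \<in> carrier SymG" and h: "h \<in> carrier SymG"
  shows "act (g \<otimes>\<^bsub>SymG\<^esub> h) u = act g (act h u)"
proof -
  obtain \<sigma> j r s where g_eq: "g = (\<sigma>, (j, r), s)" by (metis prod.exhaust)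
  obtain \<sigma>' j' r' s' where h_eq: "h = (\<sigma>', (j', r'), s')" by (metis prod.exhaust)
  define d where "d = (j, r) \<otimes>\<^bsub>Dih3\<^esub> (j', r')"
  have prod: "g \<otimes>\<^bsub>SymG\<^esub> h = (\<sigma>' \<circ> \<sigma>, d, s * s')"
    by (simp add: SymG_def Perm3_def Sgn_def g_eq h_eq d_def DirProd_def)
  have "\<exists>k. time_map d t = time_map (j', r') (time_map (j, r) t) + 6 * pi * of_int k" for t
  proof -
    define i where "i = j + (if r then - j' else j')"
    have d: "d = (i mod 3, r \<noteq> r')" by (simp add: d_def Dih3_def i_def)
    have "i = i mod 3 + 3 * (i div 3)" by simp
    then have "real_of_int i = of_int (i mod 3 + 3 * (i div 3))" by (rule arg_cong)
    then have "2 * pi * real_of_int i = 2 * pi * (of_int (i mod 3) + 3 * of_int (i div 3))"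
      by (simp only: of_int_add of_int_mult of_int_numeral)
    then have im: "2 * pi * real_of_int (i mod 3) = 2 * pi * of_int i - 6 * pi * of_int (i div 3)"
      by (simp add: distrib_left)
    show ?thesis
      by (rule exI[of _ "if r = r' then - (i div 3) else i div 3"])
        (unfold d time_map.simps im, auto simp: i_def algebra_simps)
  qed
  then have tm: "u (time_map d t) = u (time_map (j', r') (time_map (j, r) t))" for t
    using C2_periodic_shift[OF u] by metis
  show ?thesis
    using u act_closed[OF u h] unfolding prod unfolding g_eq h_eq act_def
    by (auto simp: tm perm_vec_def vec_eq_iff fun_eq_iff simp del: time_map.simps)
qed

lemma act_one: "u \<in> C2_periodic \<Longrightarrow> act \<one>\<^bsub>SymG\<^esub> u = u"
  by (simp add: act_def SymG_def Perm3_def Dih3_def Sgn_def perm_vec_def)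

lemma group_action_act: "group_action SymG C2_periodic act"
proof -
  have bij: "act g \<in> Bij C2_periodic" if g: "g \<in> carrier SymG" for g
  proof -
    let ?i = "inv\<^bsub>SymG\<^esub> g"
    have i: "?i \<in> carrier SymG" by (rule group.inv_closed[OF group_SymG g])
    have "bij_betw (act g) C2_periodic C2_periodic"
    proof (rule bij_betwI[where g = "act ?i"])
      show "act ?i (act g u) = u" if "u \<in> C2_periodic" for u
        using act_mult[OF that i g] act_one[OF that] group.l_inv[OF group_SymG g] by simp
      show "act g (act ?i u) = u" if "u \<in> C2_periodic" for u
        using act_mult[OF that g i] act_one[OF that] group.r_inv[OF group_SymG g] by simp
    qed (use act_closed g i in auto)
    moreover have "act g \<in> extensional C2_periodic"
      by (cases g) (auto simp: act_def)
    ultimately show ?thesis by (simp add: Bij_def)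
  qed
  have mult: "act (g \<otimes>\<^bsub>SymG\<^esub> h) = compose C2_periodic (act g) (act h)"
    if g: "g \<in> carrier SymG" and h: "h \<in> carrier SymG" for g h
  proof (rule extensionalityI[where A = C2_periodic])
    have "g \<otimes>\<^bsub>SymG\<^esub> h \<in> carrier SymG"
      using g h by (intro monoid.m_closed group.is_monoid group_SymG)
    then show "act (g \<otimes>\<^bsub>SymG\<^esub> h) \<in> extensional C2_periodic"
      using bij by (auto simp: Bij_def)
    show "compose C2_periodic (act g) (act h) \<in> extensional C2_periodic" by simp
    show "act (g \<otimes>\<^bsub>SymG\<^esub> h) u = compose C2_periodic (act g) (act h) u"
      if "u \<in> C2_periodic" for u
      using act_mult[OF that g h] that by (simp add: compose_def)
  qed
  have "act \<in> hom SymG (BijGroup C2_periodic)"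
    by (rule homI) (auto simp: BijGroup_def bij mult)
  then show ?thesis
    unfolding group_action_def group_hom_def group_hom_axioms_def
    using group_SymG group_BijGroup by blast
qed

lemma H_D1_D3p_explicit:
  "H_D1_D3p = (\<Union>d\<in>carrier Dih3. {(id, d, 1), (tau, d, -1)})"
proof -
  have "tau 2 = 3" by (simp add: tau_def)
  then have ne: "tau \<noteq> id" by auto
  have "bij tau" by (simp add: tau_def)
  have inv: "inv\<^bsub>Perm3\<^esub> tau = tau"
    by (rule group.inv_equality[OF group_Perm3]) (use \<open>bij tau\<close> in \<open>auto simp: Perm3_def tau_def\<close>)
  have "a = id \<or> a = tau" if "a \<in> generate Perm3 {tau}" for a
  proof -
    have "tau \<circ> tau = id" by (simp add: tau_def)
    with that show ?thesis by induction (auto simp: inv, auto simp: Perm3_def)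
  qed
  moreover have "id \<in> generate Perm3 {tau}" "tau \<in> generate Perm3 {tau}"
    using generate.one[of Perm3 "{tau}"] generate.incl[of tau "{tau}" Perm3] by (auto simp: Perm3_def)
  ultimately have gen: "generate Perm3 {tau} = {id, tau}" by blast
  show ?thesis
    unfolding H_D1_D3p_def gen using ne by (auto simp: DirProd_def Sgn_def)
qed

end

theory Submission
  imports Defs "HOL-Complex_Analysis.Great_Picard"
begin

text \<open>
  The three isotropy groups force the shape of the solutions. A function fixed by
  \<open>D\<^sub>3 \<times> D\<^sub>3\<close> or by \<open>D\<^sub>3 \<times> D\<^sub>3\<^sup>z\<close> is \<open>z(t) (1, 1, 1)\<close> with \<open>z\<close> of period \<open>2\<pi>\<close> and even or odd,
  respectively; one fixed by the first group of the theorem is \<open>z(t) (0, 1, -1)\<close> with \<open>z\<close> even of period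
  \<open>2\<pi>\<close>. By equivariance and oddness \<open>f(t, \<cdot>)\<close> maps both lines into themselves, so on each of them the
  system is a scalar equation \<open>z'' = g(t, z)\<close>. These lines are eigenspaces of the linearization, with
  eigenvalues \<open>\<mu> = -2\<close> and \<open>\<mu> = -1/2\<close>. Conversely, any nonzero \<open>z\<close> of this period and parity yields exactly
  the required isotropy group, and the orbit consists of the functions \<open>\<plusminus>z(t) \<sigma>e\<close>
  (\<open>profile_orbit\<close>). What is left is to find nonzero periodic solutions of two scalar equations.

  They lie between a lower and an upper solution. A large constant is an upper solution because \<open>g(t, x) > 0\<close>
  for large \<open>x\<close>. In the even case a small positive constant is a lower solution because \<open>\<mu> < 0\<close>
  (\<open>even_periodic_solution\<close>); in the odd case a small multiple of \<open>sin t\<close> is one because \<open>\<mu> = -2 < -1\<close>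
  (\<open>odd_periodic_solution\<close>). Even and odd periodic solutions are the reflections of solutions of Neumann and
  Dirichlet problems on \<open>[0, \<pi>]\<close>.

  As \<open>g\<close> is only continuous, initial values do not determine solutions, and the shooting method does not
  apply directly to these boundary value problems. It applies to the equation
  \<open>x''(t) = G(t, x(max 0 (t - h)))\<close> with delay \<open>h > 0\<close> and truncated right-hand side \<open>G\<close>. Compactness gives a
  solution of the original problem in the limit \<open>h \<rightarrow> 0\<close> (\<open>delayed_limit\<close>, \<open>neumann_solution\<close>,
  \<open>dirichlet_solution\<close>), and the maximum principle removes the truncation.
\<close>

section \<open>Primitives and second-order equations\<close>

text \<open>
  The substitution \<open>s = t * r\<close> turns \<open>\<integral>\<^sub>0\<^sup>t w(s) ds\<close> into an integral over the fixed interval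
  \<open>[0, 1]\<close>. One formula then serves for both signs of \<open>t\<close>, and continuous dependence on parameters
  and on \<open>t\<close> is the same question.
\<close>

definition prim :: "(real \<Rightarrow> real) \<Rightarrow> real \<Rightarrow> real" where
  "prim w t = integral {0..1} (\<lambda>r. t * w (t * r))"

lemma prim_zero [simp]: "prim w 0 = 0"
  by (simp add: prim_def)

lemma prim_cong:
  assumes "\<And>s. 0 \<le> s \<Longrightarrow> s \<le> t \<Longrightarrow> w s = w' s" and "0 \<le> t"
  shows "prim w t = prim w' t"
  unfolding prim_def using assms by (intro integral_cong) (auto simp: mult_left_le)

lemma continuous_prim_param:
  fixes w :: "'p::topological_space \<Rightarrow> real \<Rightarrow> real"
  assumes "continuous_on UNIV (\<lambda>(p, t). w p t)"
  shows "continuous_on UNIV (\<lambda>(p, t). prim (w p) t)"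
proof -
  have "continuous_on UNIV (\<lambda>((p, t), r). t * w p (t * r))"
    unfolding split_beta
    by (intro continuous_intros continuous_on_compose2[OF assms, unfolded split_beta, of _ "\<lambda>x. (f x, g x)" for f g, simplified])
  then have "continuous_on (UNIV \<times> cbox 0 1) (\<lambda>(q, r). snd q * w (fst q) (snd q * r))"
    by (auto simp: split_beta intro: continuous_on_subset)
  from integral_continuous_on_param[OF this] show ?thesis
    by (simp add: prim_def split_beta)
qed

lemma DERIV_prim:
  assumes w: "continuous_on UNIV w"
  shows "(prim w has_real_derivative w t) (at t)"
proof -
  have "\<exists>F. \<forall>x::real. (F has_real_derivative w x) (at x)"
    using einterval_antiderivative[of "-\<infinity>" \<infinity> w] w
    by (auto simp: continuous_on_eq_continuous_at has_real_derivative_iff_has_vector_derivative)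
  then obtain F where F: "\<And>x. (F has_real_derivative w x) (at x)" by blast
  have "prim w t = F t - F 0" for t
  proof -
    have "((\<lambda>r. F (t * r)) has_real_derivative w (t * r) * t) (at r within {0..1})" for r
      by (rule DERIV_chain2[OF F]) (auto intro!: derivative_eq_intros)
    then have "((\<lambda>r. t * w (t * r)) has_integral F (t * 1) - F (t * 0)) {0..1}"
      by (intro fundamental_theorem_of_calculus)
        (auto simp: has_real_derivative_iff_has_vector_derivative mult.commute)
    from integral_unique[OF this] show ?thesis by (simp add: prim_def)
  qed
  then have "prim w = (\<lambda>t. F t - F 0)" by auto
  then show ?thesis using F by (auto intro!: derivative_eq_intros)
qed

lemma continuous_prim:
  assumes "continuous_on UNIV w"
  shows "continuous_on UNIV (prim w)"
  using DERIV_prim[OF assms] by (meson DERIV_isCont continuous_at_imp_continuous_on)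

lemma prim_le:
  assumes w: "continuous_on UNIV w" and le: "\<And>s. 0 \<le> s \<Longrightarrow> s \<le> t \<Longrightarrow> w s \<le> K" and "0 \<le> t"
  shows "prim w t \<le> t * K"
proof -
  have "(\<lambda>r. t * w (t * r)) integrable_on {0..1}"
    by (intro integrable_continuous_real continuous_intros continuous_on_compose2[OF w]) auto
  then have "prim w t \<le> integral {0..1} (\<lambda>r::real. t * K)"
    unfolding prim_def using assms(3)
    by (intro integral_le) (auto intro!: mult_left_mono le simp: mult_left_le)
  then show ?thesis by simp
qed

lemma prim_uminus: "prim (\<lambda>s. - w s) t = - prim w t"
  by (simp add: prim_def)

lemma prim_abs_le:
  assumes w: "continuous_on UNIV w" and le: "\<And>s. 0 \<le> s \<Longrightarrow> s \<le> t \<Longrightarrow> \<bar>w s\<bar> \<le> K" and "0 \<le> t"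
  shows "\<bar>prim w t\<bar> \<le> t * K"
proof -
  have "w s \<le> K" "- w s \<le> K" if "0 \<le> s" "s \<le> t" for s
    using le[OF that] by (auto simp: abs_le_iff)
  then show ?thesis
    using prim_le[OF w, of t K] prim_le[OF continuous_on_minus[OF w], of t K] assms(3)
    by (auto simp: prim_uminus abs_le_iff)
qed

lemma prim_abs_le_interval:
  assumes "continuous_on UNIV w" "\<And>s. 0 \<le> s \<Longrightarrow> s \<le> T \<Longrightarrow> \<bar>w s\<bar> \<le> K" "0 \<le> t" "t \<le> T" "0 \<le> K"
  shows "\<bar>prim w t\<bar> \<le> T * K"
proof -
  have "\<bar>prim w t\<bar> \<le> t * K" using assms by (intro prim_abs_le) auto
  also have "\<dots> \<le> T * K" using assms by (intro mult_right_mono) auto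
  finally show ?thesis .
qed

lemma prim_prim_abs_le:
  assumes w: "continuous_on UNIV w" and le: "\<And>s. 0 \<le> s \<Longrightarrow> s \<le> T \<Longrightarrow> \<bar>w s\<bar> \<le> K"
    and t: "0 \<le> t" "t \<le> T" and K: "0 \<le> K"
  shows "\<bar>prim (prim w) t\<bar> \<le> T * (T * K)"
  using t K by (intro prim_abs_le_interval continuous_prim w le) auto

lemma tendsto_prim:
  assumes w: "\<And>n. continuous_on UNIV (w n)"
    and bound: "\<And>n s. 0 \<le> s \<Longrightarrow> s \<le> t \<Longrightarrow> \<bar>w n s\<bar> \<le> K"
    and lim: "\<And>s. 0 \<le> s \<Longrightarrow> s \<le> t \<Longrightarrow> (\<lambda>n. w n s) \<longlonglongrightarrow> W s" and t: "0 \<le> t"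
  shows "(\<lambda>n. prim (w n) t) \<longlonglongrightarrow> prim W t"
  unfolding prim_def
proof (rule dominated_convergence(2))
  show "(\<lambda>r. t * w n (t * r)) integrable_on {0..1}" for n
    by (intro integrable_continuous_real continuous_intros continuous_on_compose2[OF w]) auto
  show "(\<lambda>r. t * K) integrable_on {0..1::real}" by (rule integrable_const_ivl)
  show "norm (t * w n (t * r)) \<le> t * K" if "r \<in> {0..1}" for n r
    using that t bound[of "t * r" n] by (auto simp: abs_mult mult_left_le intro!: mult_left_mono)
  show "(\<lambda>n. t * w n (t * r)) \<longlonglongrightarrow> t * W (t * r)" if "r \<in> {0..1}" for r
    using that t by (intro tendsto_intros lim) (auto simp: mult_left_le)
qed

lemma tendsto_prim_prim:
  assumes w: "\<And>n. continuous_on UNIV (w n)"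
    and bound: "\<And>n s. 0 \<le> s \<Longrightarrow> s \<le> T \<Longrightarrow> \<bar>w n s\<bar> \<le> K"
    and lim: "\<And>s. 0 \<le> s \<Longrightarrow> s \<le> T \<Longrightarrow> (\<lambda>n. w n s) \<longlonglongrightarrow> W s"
    and t: "0 \<le> t" "t \<le> T" and "0 \<le> K"
  shows "(\<lambda>n. prim (prim (w n)) t) \<longlonglongrightarrow> prim (prim W) t"
proof (rule tendsto_prim)
  show "continuous_on UNIV (prim (w n))" for n by (rule continuous_prim[OF w])
  show "\<bar>prim (w n) s\<bar> \<le> T * K" if "0 \<le> s" "s \<le> t" for n s
    using that t assms(6) by (intro prim_abs_le_interval w bound) auto
  show "(\<lambda>n. prim (w n) s) \<longlonglongrightarrow> prim W s" if "0 \<le> s" "s \<le> t" for s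
    using that t by (intro tendsto_prim[OF w bound lim]) auto
qed (use t in auto)

section \<open>Boundary value problems with bounded right-hand side\<close>

text \<open>
  The parameter \<open>p\<close> holds the initial position and velocity. The delayed equation
  \<open>x''(t) = G(t, x(max 0 (t - h)))\<close> determines \<open>x\<close> on \<open>[0, (m + 1) h]\<close> from its values on
  \<open>[0, m h]\<close>. Unlike \<open>x'' = G(t, x)\<close> with a merely continuous \<open>G\<close>, its initial value problem
  therefore has a unique solution, which depends continuously on \<open>p\<close>.
\<close>

primrec delayed_iterate ::
    "(real \<times> real \<Rightarrow> real) \<Rightarrow> real \<Rightarrow> nat \<Rightarrow> real \<times> real \<Rightarrow> real \<Rightarrow> real" where
  "delayed_iterate G h 0 p t = fst p + snd p * t"
| "delayed_iterate G h (Suc m) p t =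
     fst p + snd p * t + prim (prim (\<lambda>s. G (s, delayed_iterate G h m p (max 0 (s - h))))) t"

lemma continuous_delayed_iterate:
  assumes G: "continuous_on UNIV G"
  shows "continuous_on UNIV (\<lambda>(p, t). delayed_iterate G h m p t)"
proof (induction m)
  case 0
  then show ?case by (auto simp: split_beta intro!: continuous_intros)
next
  case (Suc m)
  have "continuous_on UNIV (\<lambda>q::(real \<times> real) \<times> real. (fst q, max 0 (snd q - h)))"
    by (intro continuous_intros)
  from continuous_on_compose2[OF Suc this]
  have "continuous_on UNIV (\<lambda>q. delayed_iterate G h m (fst q) (max 0 (snd q - h)))"
    by (simp add: split_beta)
  then have "continuous_on UNIV (\<lambda>(p, s). G (s, delayed_iterate G h m p (max 0 (s - h))))"
    unfolding split_beta by (intro continuous_on_compose2[OF G] continuous_intros) auto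
  note * = continuous_prim_param[OF continuous_prim_param[OF this]]
  show ?case
    using * by (auto simp: split_beta intro!: continuous_intros)
qed

text \<open>
  Each iteration extends the interval on which the iterates have become stationary by the delay.
\<close>

lemma delayed_iterate_stationary:
  assumes "h > 0"
  shows "0 \<le> t \<Longrightarrow> t \<le> of_nat m * h \<Longrightarrow> delayed_iterate G h (Suc m) p t = delayed_iterate G h m p t"
proof (induction m arbitrary: t)
  case (Suc m)
  have "delayed_iterate G h (Suc m) p (max 0 (s - h)) = delayed_iterate G h m p (max 0 (s - h))"
    if "s \<le> t" for s
    using that Suc.prems assms by (intro Suc.IH) (auto simp: algebra_simps)
  then have "prim (prim (\<lambda>s. G (s, delayed_iterate G h (Suc m) p (max 0 (s - h))))) t
      = prim (prim (\<lambda>s. G (s, delayed_iterate G h m p (max 0 (s - h))))) t"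
    using Suc.prems by (intro prim_cong) auto
  then show ?case by (simp only: delayed_iterate.simps)
qed simp

lemma delayed_flow:
  fixes G :: "real \<times> real \<Rightarrow> real"
  assumes G: "continuous_on UNIV G" and h: "h > 0"
  obtains X where "continuous_on UNIV (\<lambda>(p, t). X p t)"
    and "\<And>p t. 0 \<le> t \<Longrightarrow> t \<le> T \<Longrightarrow>
      X p t = fst p + snd p * t + prim (prim (\<lambda>s. G (s, X p (max 0 (s - h))))) t"
proof -
  obtain m where "T / h \<le> of_nat m" using real_arch_simple by blast
  then have m: "T \<le> of_nat m * h" using h by (simp add: field_simps)
  show ?thesis
  proof (rule that)
    show "continuous_on UNIV (\<lambda>(p, t). delayed_iterate G h m p t)"
      by (rule continuous_delayed_iterate[OF G])
    show "delayed_iterate G h m p t = fst p + snd p * t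
        + prim (prim (\<lambda>s. G (s, delayed_iterate G h m p (max 0 (s - h))))) t"
      if "0 \<le> t" "t \<le> T" for p t
      using delayed_iterate_stationary[OF h, of t m G p] that m by simp
  qed
qed

text \<open>
  As the delay tends to zero, solutions of the delayed equations subconverge to a solution of
  \<open>y'' = G(t, y)\<close>: since \<open>G\<close> and the initial data are bounded, the solutions are uniformly bounded
  and share a Lipschitz constant, so the Arzela-Ascoli theorem applies, and bounded convergence carries the
  integral equation to the limit. The convergence of initial data, of values and of final velocities
  lets boundary conditions pass to the limit.
\<close>

lemma delayed_limit:
  fixes G :: "real \<times> real \<Rightarrow> real" and x :: "nat \<Rightarrow> real \<Rightarrow> real" and a b h :: "nat \<Rightarrow> real"
  defines "w \<equiv> \<lambda>n s. G (s, x n (max 0 (s - h n)))"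
  assumes G: "continuous_on UNIV G" and K: "\<And>s y. 0 \<le> s \<Longrightarrow> s \<le> T \<Longrightarrow> \<bar>G (s, y)\<bar> \<le> K"
    and T: "0 < T" and x: "\<And>n. continuous_on UNIV (x n)"
    and eq: "\<And>n t. 0 \<le> t \<Longrightarrow> t \<le> T \<Longrightarrow> x n t = a n + b n * t + prim (prim (w n)) t"
    and h: "\<And>n. h n > 0" "h \<longlonglongrightarrow> 0" and a: "\<And>n. \<bar>a n\<bar> \<le> A" and b: "\<And>n. \<bar>b n\<bar> \<le> B"
  obtains k c d y where "strict_mono (k :: nat \<Rightarrow> nat)" "continuous_on {0..T} y"
    "(\<lambda>n. a (k n)) \<longlonglongrightarrow> c" "(\<lambda>n. b (k n)) \<longlonglongrightarrow> d"
    "\<And>t. 0 \<le> t \<Longrightarrow> t \<le> T \<Longrightarrow> (\<lambda>n. x (k n) t) \<longlonglongrightarrow> y t"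
    "\<And>t. 0 \<le> t \<Longrightarrow> t \<le> T \<Longrightarrow> y t = c + d * t + prim (prim (\<lambda>s. G (s, y s))) t"
    "(\<lambda>n. prim (w (k n)) T) \<longlonglongrightarrow> prim (\<lambda>s. G (s, y s)) T"
proof -
  have K0: "0 \<le> K" using K[of 0 0] T by auto
  define L where "L = B + T * K"
  have L0: "0 \<le> L" using b[of 0] K0 T by (auto simp: L_def)
  have w: "continuous_on UNIV (w n)" for n
    unfolding w_def by (intro continuous_on_compose2[OF G] continuous_on_compose2[OF x] continuous_intros) auto
  have wK: "\<bar>w n s\<bar> \<le> K" if "0 \<le> s" "s \<le> T" for n s
    unfolding w_def using that by (rule K)
  have bound: "\<bar>x n t\<bar> \<le> A + B * T + T * (T * K)" if t: "0 \<le> t" "t \<le> T" for n t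
  proof -
    have "\<bar>b n * t\<bar> \<le> B * T"
      unfolding abs_mult using b[of n] t by (intro mult_mono) auto
    moreover have "\<bar>prim (prim (w n)) t\<bar> \<le> T * (T * K)"
      using t by (intro prim_prim_abs_le w wK K0) auto
    ultimately show ?thesis using eq[OF t, of n] a[of n] by (auto simp: abs_le_iff)
  qed
  have lip: "\<bar>x n t - x n s\<bar> \<le> L * \<bar>t - s\<bar>" if t: "t \<in> {0..T}" and s: "s \<in> {0..T}" for n s t
  proof -
    let ?y = "\<lambda>t. a n + b n * t + prim (prim (w n)) t"
    have "(?y has_real_derivative b n + prim (w n) t) (at t within {0..T})" for t
      by (auto intro!: derivative_eq_intros DERIV_subset[OF DERIV_prim] continuous_prim w)
    moreover have "norm (b n + prim (w n) t) \<le> L" if "t \<in> {0..T}" for t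
    proof -
      have "\<bar>prim (w n) t\<bar> \<le> T * K"
        using that by (intro prim_abs_le_interval w wK K0) auto
      then show ?thesis using b[of n] by (auto simp: L_def abs_le_iff)
    qed
    ultimately have "norm (?y t - ?y s) \<le> L * norm (t - s)"
      by (intro field_differentiable_bound[where S = "{0..T}"] s t) auto
    then show ?thesis using s t by (simp add: eq)
  qed
  obtain y k where y: "continuous_on {0..T} y" and k: "strict_mono (k :: nat \<Rightarrow> nat)"
    and unif: "\<And>e. 0 < e \<Longrightarrow> \<exists>N. \<forall>n t. n \<ge> N \<and> t \<in> {0..T} \<longrightarrow> norm (x (k n) t - y t) < e"
  proof (rule Arzela_Ascoli[of "{0..T}" x "A + B * T + T * (T * K)"])
    show "compact {0..T}" by simp
    show "norm (x n t) \<le> A + B * T + T * (T * K)" if "t \<in> {0..T}" for n t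
      using bound that by auto
    show "\<exists>d>0. \<forall>n s. s \<in> {0..T} \<and> norm (t - s) < d \<longrightarrow> norm (x n t - x n s) < e"
      if t: "t \<in> {0..T}" and e: "0 < e" for t e
    proof (intro exI conjI allI impI)
      show "0 < e / (L + 1)" using L0 e by simp
      fix n s assume s: "s \<in> {0..T} \<and> norm (t - s) < e / (L + 1)"
      have "norm (x n t - x n s) \<le> L * \<bar>t - s\<bar>" using lip t s by auto
      also have "\<dots> \<le> (L + 1) * \<bar>t - s\<bar>" by (intro mult_right_mono) auto
      also have "\<dots> < e" using s L0 by (simp add: field_simps)
      finally show "norm (x n t - x n s) < e" .
    qed
  qed blast
  have lim: "(\<lambda>n. x (k n) t) \<longlonglongrightarrow> y t" if "0 \<le> t" "t \<le> T" for t
    using unif that by (force simp: LIMSEQ_def dist_norm)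
  have hk: "(\<lambda>n. h (k n)) \<longlonglongrightarrow> 0"
    using LIMSEQ_subseq_LIMSEQ[OF h(2) k] by (simp add: o_def)
  have wlim: "(\<lambda>n. w (k n) s) \<longlonglongrightarrow> G (s, y s)" if s: "0 \<le> s" "s \<le> T" for s
  proof -
    have "(\<lambda>n. x (k n) (max 0 (s - h (k n))) - x (k n) s) \<longlonglongrightarrow> 0"
    proof (rule Lim_null_comparison)
      have "\<bar>x n (max 0 (s - h n)) - x n s\<bar> \<le> L * h n" for n
      proof -
        have "\<bar>x n (max 0 (s - h n)) - x n s\<bar> \<le> L * \<bar>max 0 (s - h n) - s\<bar>"
          using s h(1)[of n] by (intro lip) auto
        also have "\<dots> \<le> L * h n" using s h(1)[of n] L0 by (intro mult_left_mono) auto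
        finally show ?thesis .
      qed
      then show "\<forall>\<^sub>F n in sequentially. norm (x (k n) (max 0 (s - h (k n))) - x (k n) s) \<le> L * h (k n)"
        by simp
      show "(\<lambda>n. L * h (k n)) \<longlonglongrightarrow> 0"
        using tendsto_mult_left[OF hk, of L] by simp
    qed
    from tendsto_add[OF this lim[OF s]]
    have "(\<lambda>n. (s, x (k n) (max 0 (s - h (k n))))) \<longlonglongrightarrow> (s, y s)"
      by (intro tendsto_Pair) auto
    then show ?thesis
      unfolding w_def by (rule continuous_on_tendsto_compose[OF G]) auto
  qed
  have pp: "(\<lambda>n. prim (prim (w (k n))) t) \<longlonglongrightarrow> prim (prim (\<lambda>s. G (s, y s))) t"
    if "0 \<le> t" "t \<le> T" for t
    using that by (intro tendsto_prim_prim[OF w wK wlim _ _ K0]) auto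
  have alim: "(\<lambda>n. a (k n)) \<longlonglongrightarrow> y 0"
    using lim[of 0] T by (simp add: eq)
  \<comment> \<open>The integral equation at \<open>t = T\<close> expresses the initial velocity by quantities
      that converge; its limit needs no further subsequence.\<close>
  define d where "d = (y T - y 0 - prim (prim (\<lambda>s. G (s, y s))) T) / T"
  have "b n = (x n T - a n - prim (prim (w n)) T) / T" for n
    using eq[of T n] T by (simp add: field_simps)
  then have blim: "(\<lambda>n. b (k n)) \<longlonglongrightarrow> d"
    unfolding d_def using T by (simp, intro tendsto_intros lim alim pp) auto
  show ?thesis
  proof (rule that[OF k y alim blim lim])
    show "y t = y 0 + d * t + prim (prim (\<lambda>s. G (s, y s))) t" if t: "0 \<le> t" "t \<le> T" for t
    proof (rule LIMSEQ_unique[OF lim[OF t]])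
      have "(\<lambda>n. a (k n) + b (k n) * t + prim (prim (w (k n))) t)
          \<longlonglongrightarrow> y 0 + d * t + prim (prim (\<lambda>s. G (s, y s))) t"
        by (intro tendsto_intros alim blim pp t)
      then show "(\<lambda>n. x (k n) t) \<longlonglongrightarrow> y 0 + d * t + prim (prim (\<lambda>s. G (s, y s))) t"
        using t by (simp add: eq)
    qed
    show "(\<lambda>n. prim (w (k n)) T) \<longlonglongrightarrow> prim (\<lambda>s. G (s, y s)) T"
      using T by (intro tendsto_prim[OF w wK wlim]) auto
  qed
qed

text \<open>
  Shooting from \<open>y 0 = 0\<close>: the boundedness of \<open>G\<close> makes the initial velocities \<open>\<plusminus>T K\<close> end on
  either side of the target \<open>y T = 0\<close>, and the intermediate value theorem hits it for every delay.
\<close>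

lemma dirichlet_solution:
  fixes G :: "real \<times> real \<Rightarrow> real"
  assumes G: "continuous_on UNIV G" and K: "\<And>s y. 0 \<le> s \<Longrightarrow> s \<le> T \<Longrightarrow> \<bar>G (s, y)\<bar> \<le> K" and T: "0 < T"
  obtains d y where "continuous_on {0..T} y" "y T = 0"
    "\<And>t. 0 \<le> t \<Longrightarrow> t \<le> T \<Longrightarrow> y t = d * t + prim (prim (\<lambda>s. G (s, y s))) t"
proof -
  have K0: "0 \<le> K" using K[of 0 0] T by auto
  have approx: "\<exists>x b. continuous_on UNIV x \<and> \<bar>b\<bar> \<le> T * K \<and> x T = 0 \<and>
      (\<forall>t. 0 \<le> t \<longrightarrow> t \<le> T \<longrightarrow> x t = 0 + b * t + prim (prim (\<lambda>s. G (s, x (max 0 (s - h))))) t)"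
    if h: "0 < h" for h
  proof -
    obtain X where X: "continuous_on UNIV (\<lambda>(p, t). X p t)" and eq: "\<And>p t. 0 \<le> t \<Longrightarrow> t \<le> T \<Longrightarrow>
      X p t = fst p + snd p * t + prim (prim (\<lambda>s. G (s, X p (max 0 (s - h))))) t"
      by (rule delayed_flow[OF G h, of T]) blast
    have Xp: "continuous_on UNIV (X p)" for p
      using continuous_on_compose2[OF X, of UNIV "\<lambda>t. (p, t)"] by (simp add: continuous_on_Pair)
    have Xb: "continuous_on A (\<lambda>b. X (0, b) T)" for A
      using continuous_on_compose2[OF X, of A "\<lambda>b. ((0, b), T)"]
      by (simp add: continuous_on_Pair)
    have "\<bar>prim (prim (\<lambda>s. G (s, X p (max 0 (s - h))))) T\<bar> \<le> T * (T * K)" for p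
      using T K0
      by (intro prim_prim_abs_le continuous_on_compose2[OF G] continuous_on_compose2[OF Xp]
          continuous_intros K) auto
    note pp = this[unfolded abs_le_iff]
    have "X (0, - (T * K)) T \<le> 0" "0 \<le> X (0, T * K) T"
      using pp[of "(0, - (T * K))"] pp[of "(0, T * K)"] T by (simp_all add: eq algebra_simps)
    moreover have "- (T * K) \<le> T * K" using T K0 by simp
    ultimately obtain b where "- (T * K) \<le> b" "b \<le> T * K" "X (0, b) T = 0"
      using IVT'[of "\<lambda>b. X (0, b) T" "- (T * K)" 0 "T * K"] Xb by blast
    then show ?thesis using Xp eq[of _ "(0, b)"]
      by (intro exI[of _ "X (0, b)"] exI[of _ b]) (auto simp: abs_le_iff)
  qed
  define P where "P = (\<lambda>h x b. continuous_on UNIV x \<and> \<bar>b\<bar> \<le> T * K \<and> x T = 0 \<and>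
      (\<forall>t. 0 \<le> t \<longrightarrow> t \<le> T \<longrightarrow> x t = 0 + b * t + prim (prim (\<lambda>s. G (s, x (max 0 (s - h))))) t))"
  have "\<forall>n. \<exists>x b. P (1 / Suc n) x b"
    unfolding P_def by (intro allI approx) simp
  then obtain x b where "\<And>n. P (1 / Suc n) (x n) (b n)" by metis
  then have xb: "\<And>n. continuous_on UNIV (x n)" "\<And>n. \<bar>b n\<bar> \<le> T * K" "\<And>n. x n T = 0"
    "\<And>n t. 0 \<le> t \<Longrightarrow> t \<le> T \<Longrightarrow> x n t = 0 + b n * t + prim (prim (\<lambda>s. G (s, x n (max 0 (s - 1 / Suc n))))) t"
    unfolding P_def by blast+
  show ?thesis
  proof (rule delayed_limit[where h = "\<lambda>n. 1 / Suc n" and a = "\<lambda>n. 0" and A = 0, OF G K T xb(1) xb(4) _ _ _ xb(2)])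
    show "(\<lambda>n. 1 / real (Suc n)) \<longlonglongrightarrow> 0" using LIMSEQ_inverse_real_of_nat by (simp add: inverse_eq_divide)
    fix k c d y assume *: "continuous_on {0..T} y" "(\<lambda>n. 0) \<longlonglongrightarrow> c"
      "\<And>t. 0 \<le> t \<Longrightarrow> t \<le> T \<Longrightarrow> (\<lambda>n. x (k n) t) \<longlonglongrightarrow> y t"
      "\<And>t. 0 \<le> t \<Longrightarrow> t \<le> T \<Longrightarrow> y t = c + d * t + prim (prim (\<lambda>s. G (s, y s))) t"
    have "c = 0" using *(2) by (simp add: LIMSEQ_const_iff)
    moreover have "y T = 0" using *(3)[of T] T by (simp add: xb(3) LIMSEQ_const_iff)
    ultimately show ?thesis using *(1,4) by (intro that[of y d]) auto
  qed auto
qed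

text \<open>
  Shooting from zero initial velocity: solutions stay within \<open>D = T\<^sup>2 K\<close> of their starting point, so
  one that starts \<open>D\<close> above \<open>R\<close> (or below \<open>r\<close>) meets only one sign of \<open>G\<close>, which is the sign of its
  final velocity.
\<close>

lemma neumann_solution:
  fixes G :: "real \<times> real \<Rightarrow> real"
  assumes G: "continuous_on UNIV G" and K: "\<And>s y. 0 \<le> s \<Longrightarrow> s \<le> T \<Longrightarrow> \<bar>G (s, y)\<bar> \<le> K" and T: "0 < T"
    and hi: "\<And>s y. 0 \<le> s \<Longrightarrow> s \<le> T \<Longrightarrow> R \<le> y \<Longrightarrow> 0 \<le> G (s, y)"
    and lo: "\<And>s y. 0 \<le> s \<Longrightarrow> s \<le> T \<Longrightarrow> y \<le> r \<Longrightarrow> G (s, y) \<le> 0" and rR: "r \<le> R"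
  obtains c y where "continuous_on {0..T} y" "prim (\<lambda>s. G (s, y s)) T = 0"
    "\<And>t. 0 \<le> t \<Longrightarrow> t \<le> T \<Longrightarrow> y t = c + prim (prim (\<lambda>s. G (s, y s))) t"
proof -
  have K0: "0 \<le> K" using K[of 0 0] T by auto
  define D where "D = T * (T * K)"
  have D0: "0 \<le> D" using T K0 by (simp add: D_def)
  have approx: "\<exists>x a. continuous_on UNIV x \<and> \<bar>a\<bar> \<le> \<bar>R\<bar> + \<bar>r\<bar> + D \<and>
      prim (\<lambda>s. G (s, x (max 0 (s - h)))) T = 0 \<and>
      (\<forall>t. 0 \<le> t \<longrightarrow> t \<le> T \<longrightarrow> x t = a + 0 * t + prim (prim (\<lambda>s. G (s, x (max 0 (s - h))))) t)"
    if h: "0 < h" for h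
  proof -
    obtain X where X: "continuous_on UNIV (\<lambda>(p, t). X p t)" and eq: "\<And>p t. 0 \<le> t \<Longrightarrow> t \<le> T \<Longrightarrow>
      X p t = fst p + snd p * t + prim (prim (\<lambda>s. G (s, X p (max 0 (s - h))))) t"
      by (rule delayed_flow[OF G h, of T]) blast
    define w where "w = (\<lambda>a s. G (s, X (a, 0) (max 0 (s - h))))"
    have Xp: "continuous_on UNIV (X p)" for p
      using continuous_on_compose2[OF X, of UNIV "\<lambda>t. (p, t)"] by (simp add: continuous_on_Pair)
    have wc: "continuous_on UNIV (w a)" for a
      unfolding w_def by (intro continuous_on_compose2[OF G] continuous_on_compose2[OF Xp] continuous_intros) auto
    have "continuous_on UNIV (\<lambda>q. X (fst q, 0) (max 0 (snd q - h)))"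
      using continuous_on_compose2[OF X, of UNIV "\<lambda>q::real \<times> real. ((fst q, 0), max 0 (snd q - h))"]
      by (simp add: continuous_on_Pair continuous_on_max continuous_on_diff continuous_on_fst continuous_on_snd)
    then have "continuous_on UNIV (\<lambda>(a, s). w a s)"
      unfolding w_def split_beta by (intro continuous_on_compose2[OF G] continuous_intros) auto
    note wp = continuous_prim_param[OF this]
    have wa: "continuous_on A (\<lambda>a. prim (w a) T)" for A
      using continuous_on_compose2[OF wp, of A "\<lambda>a. (a, T)"] by (simp add: continuous_on_Pair)
    have near: "\<bar>X (a, 0) t - a\<bar> \<le> D" if t: "0 \<le> t" "t \<le> T" for a t
    proof -
      have "\<bar>prim (prim (w a)) t\<bar> \<le> D"
        unfolding D_def using t K0 by (intro prim_prim_abs_le wc) (auto simp: w_def K)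
      then show ?thesis by (simp add: eq[OF t] w_def)
    qed
    have "prim (w (r - D)) T \<le> T * 0"
    proof (rule prim_le[OF wc])
      fix s assume s: "0 \<le> s" "s \<le> T"
      then have "X (r - D, 0) (max 0 (s - h)) \<le> r"
        using near[of "max 0 (s - h)" "r - D"] h by (auto simp: abs_le_iff)
      then show "w (r - D) s \<le> 0" using lo s by (simp add: w_def)
    qed (use T in simp)
    moreover have "prim (\<lambda>s. - w (R + D) s) T \<le> T * 0"
    proof (rule prim_le[OF continuous_on_minus[OF wc]])
      fix s assume s: "0 \<le> s" "s \<le> T"
      then have "R \<le> X (R + D, 0) (max 0 (s - h))"
        using near[of "max 0 (s - h)" "R + D"] h by (auto simp: abs_le_iff)
      then show "- w (R + D) s \<le> 0" using hi s by (simp add: w_def)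
    qed (use T in simp)
    ultimately obtain a where "r - D \<le> a" "a \<le> R + D" "prim (w a) T = 0"
      using IVT'[of "\<lambda>a. prim (w a) T" "r - D" 0 "R + D"] wa rR D0 by (auto simp: prim_uminus)
    then show ?thesis using Xp eq[of _ "(a, 0)"]
      by (intro exI[of _ "X (a, 0)"] exI[of _ a]) (auto simp: w_def abs_le_iff)
  qed
  define P where "P = (\<lambda>h x a. continuous_on UNIV x \<and> \<bar>a\<bar> \<le> \<bar>R\<bar> + \<bar>r\<bar> + D \<and>
      prim (\<lambda>s. G (s, x (max 0 (s - h)))) T = 0 \<and>
      (\<forall>t. 0 \<le> t \<longrightarrow> t \<le> T \<longrightarrow> x t = a + 0 * t + prim (prim (\<lambda>s. G (s, x (max 0 (s - h))))) t))"
  have "\<forall>n. \<exists>x a. P (1 / Suc n) x a"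
    unfolding P_def by (intro allI approx) simp
  then obtain x a where "\<And>n. P (1 / Suc n) (x n) (a n)" by metis
  then have xa: "\<And>n. continuous_on UNIV (x n)" "\<And>n. \<bar>a n\<bar> \<le> \<bar>R\<bar> + \<bar>r\<bar> + D"
    "\<And>n. prim (\<lambda>s. G (s, x n (max 0 (s - 1 / Suc n)))) T = 0"
    "\<And>n t. 0 \<le> t \<Longrightarrow> t \<le> T \<Longrightarrow> x n t = a n + 0 * t + prim (prim (\<lambda>s. G (s, x n (max 0 (s - 1 / Suc n))))) t"
    unfolding P_def by blast+
  show ?thesis
  proof (rule delayed_limit[where h = "\<lambda>n. 1 / Suc n" and b = "\<lambda>n. 0" and B = 0, OF G K T xa(1) xa(4) _ _ xa(2)])
    show "(\<lambda>n. 1 / real (Suc n)) \<longlonglongrightarrow> 0" using LIMSEQ_inverse_real_of_nat by (simp add: inverse_eq_divide)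
    fix k c d y assume *: "continuous_on {0..T} y" "(\<lambda>n. 0) \<longlonglongrightarrow> d"
      "\<And>t. 0 \<le> t \<Longrightarrow> t \<le> T \<Longrightarrow> y t = c + d * t + prim (prim (\<lambda>s. G (s, y s))) t"
      "(\<lambda>n. prim (\<lambda>s. G (s, x (k n) (max 0 (s - 1 / Suc (k n))))) T) \<longlonglongrightarrow> prim (\<lambda>s. G (s, y s)) T"
    have "d = 0" using *(2) by (simp add: LIMSEQ_const_iff)
    moreover have "prim (\<lambda>s. G (s, y s)) T = 0" using *(4) by (simp only: xa(3) LIMSEQ_const_iff)
    ultimately show ?thesis using *(1,3) by (intro that[of y c]) auto
  qed auto
qed

section \<open>Extension by symmetry\<close>

lemma second_order_unique:
  fixes z z' :: "real \<Rightarrow> real"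
  assumes "\<And>t. (z has_real_derivative v t) (at t)" "\<And>t. (v has_real_derivative w t) (at t)"
    and "\<And>t. (z' has_real_derivative v' t) (at t)" "\<And>t. (v' has_real_derivative w t) (at t)"
    and "z p = z' p" "v p = v' p"
  shows "z = z'" "v = v'"
proof -
  have "((\<lambda>t. v t - v' t) has_real_derivative 0) (at t)" for t
    using DERIV_diff[OF assms(2) assms(4)] by simp
  then have "v t - v' t = v p - v' p" for t by (rule DERIV_isconst_all[rule_format])
  then show v: "v = v'" using assms(6) by auto
  have "((\<lambda>t. z t - z' t) has_real_derivative 0) (at t)" for t
    using DERIV_diff[OF assms(1) assms(3), of t] v by simp
  then have "z t - z' t = z p - z' p" for t by (rule DERIV_isconst_all[rule_format])
  then show "z = z'" using assms(5) by auto
qed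

text \<open>
  The functions \<open>t \<mapsto> e * z (- t)\<close> and \<open>t \<mapsto> z (t + 2 * pi)\<close> have the same second derivative as \<open>z\<close>.
  The boundary conditions make them agree with \<open>z\<close> to first order at \<open>0\<close> and at \<open>- pi\<close>, respectively;
  for \<open>e = 1\<close> these are Neumann conditions, for \<open>e = -1\<close> Dirichlet conditions.
\<close>

lemma parity_and_period_of_forcing:
  fixes z :: "real \<Rightarrow> real"
  assumes z: "\<And>t. (z has_real_derivative v t) (at t)" and v: "\<And>t. (v has_real_derivative w t) (at t)"
    and w: "\<And>t. w (- t) = e * w t" "\<And>t. w (t + 2 * pi) = w t"
    and bc: "e = 1 \<and> v 0 = 0 \<and> v pi = 0 \<or> e = -1 \<and> z 0 = 0 \<and> z pi = 0"
  shows "z (- t) = e * z t" "z (t + 2 * pi) = z t"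
proof -
  have e: "e * e = 1" using bc by auto
  have dz: "((\<lambda>t. e * z (- t)) has_real_derivative - e * v (- t)) (at t)" for t
    by (rule DERIV_cong[OF DERIV_cmult[OF DERIV_chain2[OF z]]]) (auto intro!: derivative_eq_intros)
  have "((\<lambda>t. - e * v (- t)) has_real_derivative e * w (- t)) (at t)" for t
    by (rule DERIV_cong[OF DERIV_cmult[OF DERIV_chain2[OF v]]]) (auto intro!: derivative_eq_intros)
  then have dv: "((\<lambda>t. - e * v (- t)) has_real_derivative w t) (at t)" for t
    by (simp add: w(1) e mult.assoc[symmetric])
  have par: "z t = e * z (- t)" "v t = - e * v (- t)" for t
    using second_order_unique[OF z v dz dv, of 0] bc by (auto dest: fun_cong[of _ _ t])
  show "z (- t) = e * z t" using par(1)[of "-t"] by simp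
  have "((\<lambda>t. z (t + 2 * pi)) has_real_derivative v (t + 2 * pi)) (at t)"
    "((\<lambda>t. v (t + 2 * pi)) has_real_derivative w t) (at t)" for t
    using DERIV_shift[of z "v (t + 2 * pi)" t "2 * pi"] z[of "t + 2 * pi"]
      DERIV_shift[of v "w (t + 2 * pi)" t "2 * pi"] v[of "t + 2 * pi"]
    by (simp_all add: w(2))
  note per = second_order_unique(1)[OF this z v, of "-pi"]
  show "z (t + 2 * pi) = z t"
    using per bc par[of pi] by (auto dest: fun_cong[of _ _ t])
qed

text \<open>
  The map \<open>t \<mapsto> arccos (cos t)\<close> folds the real line onto \<open>[0, pi]\<close>, and \<open>sgn (sin t)\<close> supplies the sign
  of the odd extension, whose continuity at the multiples of \<open>pi\<close> is due to \<open>W 0 = W pi = 0\<close>.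
\<close>

lemma fold_extension:
  assumes W: "continuous_on {0..pi} W" and e: "e = 1 \<or> e = -1 \<and> W 0 = 0 \<and> W pi = 0"
  obtains w :: "real \<Rightarrow> real" where "continuous_on UNIV w" "\<And>t. 0 \<le> t \<Longrightarrow> t \<le> pi \<Longrightarrow> w t = W t"
    "\<And>t. w (- t) = e * w t" "\<And>t. w (t + 2 * pi) = w t"
proof -
  have acos: "0 \<le> arccos (cos t)" "arccos (cos t) \<le> pi" for t
    by (auto intro: arccos_lbound arccos_ubound)
  have cont: "continuous_on UNIV (\<lambda>t. W (arccos (cos t)))"
    by (intro continuous_on_compose2[OF W] continuous_intros) (auto simp: acos)
  show ?thesis
  proof (cases "e = 1")
    case True
    show ?thesis
      by (rule that[of "\<lambda>t. W (arccos (cos t))"]) (auto simp: cont True arccos_cos)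
  next
    case False
    then have e: "e = -1" "W 0 = 0" "W pi = 0" using e by auto
    let ?w = "\<lambda>t. sgn (sin t) * W (arccos (cos t))"
    show ?thesis
    proof (rule that[of ?w])
      have "isCont ?w t" for t
      proof (cases "sin t = 0")
        case True
        have "cos t = 1 \<or> cos t = -1"
          using True sin_cos_squared_add[of t] by (simp add: power2_eq_1_iff)
        then have W0: "W (arccos (cos t)) = 0" using e by auto
        have "(\<lambda>s. W (arccos (cos s))) \<midarrow>t\<rightarrow> W (arccos (cos t))"
          using cont by (simp add: continuous_on_eq_continuous_at isCont_def)
        then have 0: "(\<lambda>s. W (arccos (cos s))) \<midarrow>t\<rightarrow> 0" by (simp add: W0)
        have "?w \<midarrow>t\<rightarrow> 0"
          by (rule Lim_null_comparison[OF _ tendsto_rabs_zero[OF 0]])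
            (auto simp: abs_mult abs_sgn_eq)
        then show ?thesis by (simp add: isCont_def W0)
      next
        case False
        then show ?thesis
          using cont by (intro continuous_intros) (auto simp: continuous_on_eq_continuous_at)
      qed
      then show "continuous_on UNIV ?w" by (simp add: continuous_at_imp_continuous_on)
      show "?w t = W t" if "0 \<le> t" "t \<le> pi" for t
      proof -
        have "t = 0 \<or> t = pi \<or> 0 < t \<and> t < pi" using that by linarith
        then show ?thesis
          using that e by (elim disjE) (auto simp: arccos_cos sin_gt_zero)
      qed
    qed (auto simp: e sgn_minus)
  qed
qed

lemma fold_angle:
  obtains s :: real and m :: int where "0 \<le> s" "s \<le> pi"
    "t = s + of_int m * (2 * pi) \<or> t = - s + of_int m * (2 * pi)"
proof -
  have "cos t = cos (arccos (cos t))" by simp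
  then obtain n where n: "n \<in> \<int>"
    "t = arccos (cos t) + 2 * n * pi \<or> t = - arccos (cos t) + 2 * n * pi"
    unfolding cos_eq by blast
  moreover obtain m where "n = of_int m" using n(1) by (rule Ints_cases)
  ultimately show ?thesis
    by (intro that[of "arccos (cos t)" m]) (auto simp: arccos_lbound arccos_ubound mult_ac)
qed

lemma eq_if_same_parity:
  fixes f g :: "real \<Rightarrow> real"
  assumes f: "\<And>t. f (- t) = e * f t" "\<And>t. f (t + 2 * pi) = f t"
    and g: "\<And>t. g (- t) = e * g t" "\<And>t. g (t + 2 * pi) = g t"
    and eq: "\<And>t. 0 \<le> t \<Longrightarrow> t \<le> pi \<Longrightarrow> f t = g t"
  shows "f t = g t"
proof -
  interpret f: periodic_fun_simple f "2 * pi" by unfold_locales (rule f)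
  interpret g: periodic_fun_simple g "2 * pi" by unfold_locales (rule g)
  obtain r m where r: "0 \<le> r" "r \<le> pi"
    and t: "t = r + of_int m * (2 * pi) \<or> t = - r + of_int m * (2 * pi)"
    by (rule fold_angle)
  from t show ?thesis
    by (elim disjE) (simp_all only: f.plus_of_int g.plus_of_int f(1) g(1) eq[OF r])
qed

section \<open>Periodic solutions between a lower and an upper solution\<close>

lemma second_derivative_nonneg_at_local_min:
  fixes y :: "real \<Rightarrow> real"
  assumes y: "\<And>t. (y has_real_derivative v t) (at t)" and v: "(v has_real_derivative q) (at t0)"
    and d: "0 < d" "\<And>t. \<bar>t - t0\<bar> < d \<Longrightarrow> y t0 \<le> y t"
  shows "0 \<le> q"
proof (rule ccontr)
  assume "\<not> 0 \<le> q"
  then obtain d' where d': "0 < d'" "\<And>h. 0 < h \<Longrightarrow> h < d' \<Longrightarrow> v (t0 + h) < v t0"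
    using DERIV_neg_dec_right[OF v] by auto
  have v0: "v t0 = 0"
    by (rule DERIV_local_min[OF y d(1)]) (auto simp: abs_minus_commute d(2))
  define h where "h = min d d' / 2"
  have h: "0 < h" "h < d" "h < d'" using d d' by (auto simp: h_def)
  obtain c where c: "t0 < c" "c < t0 + h" "y (t0 + h) - y t0 = (t0 + h - t0) * v c"
    using MVT2[of t0 "t0 + h" y v] h y by auto
  have "v c < 0" using d'(2)[of "c - t0"] c h v0 by auto
  then have "h * v c < 0" using h by (intro mult_pos_neg)
  moreover have "y t0 \<le> y (t0 + h)" using h by (intro d) auto
  ultimately show False using c(3) by auto
qed

text \<open>
  The constants \<open>r\<close> and \<open>R\<close> are a lower and an upper solution. Clamping the argument of \<open>g\<close> to
  \<open>[r, R]\<close> makes the right-hand side bounded, so that the Neumann problem on \<open>[0, pi]\<close> is solvable, and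
  reflecting its solution makes it periodic. The maximum principle then shows that the clamping has no effect:
  at a minimum below \<open>r\<close> the second derivative would be \<open>g (t, r) < 0\<close>, at a maximum above \<open>R\<close> it
  would be \<open>g (t, R) > 0\<close>.
\<close>

lemma even_periodic_solution:
  fixes g :: "real \<times> real \<Rightarrow> real"
  assumes g: "continuous_on UNIV g" and per: "\<And>t x. g (t + 2 * pi, x) = g (t, x)"
    and even: "\<And>t x. g (- t, x) = g (t, x)"
    and lo: "\<And>t. g (t, r) < 0" and hi: "\<And>t. 0 < g (t, R)" and rR: "r \<le> R"
  obtains z v where "\<And>t. (z has_real_derivative v t) (at t)"
    "\<And>t. (v has_real_derivative g (t, z t)) (at t)"
    "\<And>t. z (- t) = z t" "\<And>t. z (t + 2 * pi) = z t" "\<And>t. r \<le> z t" "\<And>t. z t \<le> R"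
proof -
  define G where "G = (\<lambda>(t, x). g (t, max r (min R x)))"
  have G: "continuous_on UNIV G"
    unfolding G_def split_beta by (intro continuous_on_compose2[OF g] continuous_intros) auto
  have "bounded (g ` ({0..pi} \<times> {r..R}))"
    by (intro compact_imp_bounded compact_continuous_image compact_Times continuous_on_subset[OF g]) auto
  then obtain K where K: "\<And>s y. s \<in> {0..pi} \<Longrightarrow> y \<in> {r..R} \<Longrightarrow> \<bar>g (s, y)\<bar> \<le> K"
    by (force simp: bounded_iff)
  have K: "\<bar>G (s, y)\<bar> \<le> K" if "0 \<le> s" "s \<le> pi" for s y
    unfolding G_def using that rR by (auto intro!: K)
  obtain c y where y: "continuous_on {0..pi} y" "prim (\<lambda>s. G (s, y s)) pi = 0"
    "\<And>t. 0 \<le> t \<Longrightarrow> t \<le> pi \<Longrightarrow> y t = c + prim (prim (\<lambda>s. G (s, y s))) t"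
  proof (rule neumann_solution[OF G K pi_gt_zero])
    show "0 \<le> G (s, y)" if "R \<le> y" for s y
    proof -
      have "max r (min R y) = R" using that rR by (auto simp: max_def min_def)
      then show ?thesis using hi[of s] by (simp add: G_def)
    qed
    show "G (s, y) \<le> 0" if "y \<le> r" for s y
    proof -
      have "max r (min R y) = r" using that rR by (auto simp: max_def min_def)
      then show ?thesis using lo[of s] by (simp add: G_def)
    qed
  qed (use rR in auto)
  have "continuous_on {0..pi} (\<lambda>s. G (s, y s))"
    by (intro continuous_on_compose2[OF G] continuous_intros y) auto
  then obtain w where w: "continuous_on UNIV w" "\<And>t. 0 \<le> t \<Longrightarrow> t \<le> pi \<Longrightarrow> w t = G (t, y t)"
    "\<And>t. w (- t) = 1 * w t" "\<And>t. w (t + 2 * pi) = w t"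
    by (rule fold_extension[of _ 1]) auto
  define z where "z = (\<lambda>t. c + prim (prim w) t)"
  have z: "(z has_real_derivative prim w t) (at t)" and v: "(prim w has_real_derivative w t) (at t)" for t
    unfolding z_def using w(1)
    by (auto intro!: derivative_eq_intros DERIV_prim continuous_prim)
  have vpi: "prim w pi = 0"
    using y(2) prim_cong[of pi w "\<lambda>s. G (s, y s)"] w(2) by simp
  have zsym: "z (- t) = 1 * z t" "z (t + 2 * pi) = z t" for t
    using parity_and_period_of_forcing[OF z v w(3,4)] vpi by auto
  have zy: "z t = y t" if "0 \<le> t" "t \<le> pi" for t
  proof -
    have "prim (prim w) t = prim (prim (\<lambda>s. G (s, y s))) t"
      using that by (intro prim_cong) (auto intro!: w)
    then show ?thesis using y(3)[OF that] by (simp add: z_def)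
  qed
  have w_eq: "w t = G (t, z t)" for t
    by (rule eq_if_same_parity[where f = w and g = "\<lambda>t. G (t, z t)", OF w(3,4)])
      (use zsym per even w(2) zy in \<open>auto simp: G_def\<close>)
  have zc: "continuous_on A z" for A
    using z by (meson DERIV_isCont continuous_at_imp_continuous_on)
  interpret z: periodic_fun_simple z "2 * pi" by unfold_locales (rule zsym)
  have reduce: "\<exists>s\<in>{0..pi}. z t = z s" for t
  proof -
    obtain s m where s: "0 \<le> s" "s \<le> pi"
      and t: "t = s + of_int m * (2 * pi) \<or> t = - s + of_int m * (2 * pi)"
      by (rule fold_angle)
    from t have "z t = z s"
      using zsym(1)[of s] by (elim disjE) (simp_all only: z.plus_of_int mult_1)
    then show ?thesis using s by auto
  qed
  have lower: "r \<le> z t" for t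
  proof -
    have "\<exists>t0\<in>{0..pi}. \<forall>t\<in>{0..pi}. z t0 \<le> z t"
      by (intro continuous_attains_inf zc) auto
    then obtain t0 where t0: "\<And>t. t \<in> {0..pi} \<Longrightarrow> z t0 \<le> z t" by blast
    then have min: "z t0 \<le> z t" for t using reduce[of t] by auto
    have "0 \<le> w t0"
      by (rule second_derivative_nonneg_at_local_min[OF z v, of 1]) (auto simp: min)
    then have "r \<le> z t0"
      using lo[of t0] rR by (auto simp: w_eq G_def min_def max_def split: if_splits)
    then show ?thesis using min[of t] by simp
  qed
  have upper: "z t \<le> R" for t
  proof -
    have "\<exists>t0\<in>{0..pi}. \<forall>t\<in>{0..pi}. z t \<le> z t0"
      by (intro continuous_attains_sup zc) auto
    then obtain t0 where t0: "\<And>t. t \<in> {0..pi} \<Longrightarrow> z t \<le> z t0" by blast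
    then have max: "z t \<le> z t0" for t using reduce[of t] by auto
    have "0 \<le> - w t0"
      by (rule second_derivative_nonneg_at_local_min[OF DERIV_minus[OF z] DERIV_minus[OF v], of 1])
        (auto simp: max)
    then have "z t0 \<le> R"
      using hi[of t0] rR by (auto simp: w_eq G_def min_def max_def split: if_splits)
    then show ?thesis using max[of t] by simp
  qed
  have "w t = g (t, z t)" for t
    using lower[of t] upper[of t] by (simp add: w_eq G_def min_def max_def)
  then show ?thesis using that[of z "prim w"] z v zsym lower upper by simp
qed

text \<open>
  The argument is that for even solutions, with the Dirichlet problem on \<open>[0, pi]\<close> and the lower
  solution \<open>r * sin t\<close>, which satisfies the boundary conditions and has second derivative
  \<open>- r * sin t\<close>. Where \<open>z\<close> violates a bound the extremum is interior, since both bounds hold at the end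
  points.
\<close>

lemma odd_periodic_solution:
  fixes g :: "real \<times> real \<Rightarrow> real"
  assumes g: "continuous_on UNIV g" and per: "\<And>t x. g (t + 2 * pi, x) = g (t, x)"
    and odd: "\<And>t x. g (- t, - x) = - g (t, x)"
    and lo: "\<And>t. 0 < t \<Longrightarrow> t < pi \<Longrightarrow> g (t, r * sin t) < - r * sin t" and hi: "\<And>t. 0 < g (t, R)"
    and r: "0 < r" and rR: "r \<le> R"
  obtains z v where "\<And>t. (z has_real_derivative v t) (at t)"
    "\<And>t. (v has_real_derivative g (t, z t)) (at t)"
    "\<And>t. z (- t) = - z t" "\<And>t. z (t + 2 * pi) = z t" "\<And>t. 0 \<le> t \<Longrightarrow> t \<le> pi \<Longrightarrow> r * sin t \<le> z t"
proof -
  define G where "G = (\<lambda>(t, x). g (t, max (r * sin t) (min R x)))"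
  have G: "continuous_on UNIV G"
    unfolding G_def split_beta by (intro continuous_on_compose2[OF g] continuous_intros) auto
  have "bounded (g ` ({0..pi} \<times> {0..R}))"
    by (intro compact_imp_bounded compact_continuous_image compact_Times continuous_on_subset[OF g]) auto
  then obtain K where K: "\<And>s y. s \<in> {0..pi} \<Longrightarrow> y \<in> {0..R} \<Longrightarrow> \<bar>g (s, y)\<bar> \<le> K"
    by (force simp: bounded_iff)
  have sinR: "r * sin t \<le> R" for t
  proof -
    have "r * sin t \<le> r * 1" using r by (intro mult_left_mono sin_le_one) auto
    then show ?thesis using rR by linarith
  qed
  have sin0: "0 \<le> r * sin t" if "0 \<le> t" "t \<le> pi" for t
    using that r by (simp add: sin_ge_zero)
  have K: "\<bar>G (s, y)\<bar> \<le> K" if "0 \<le> s" "s \<le> pi" for s y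
    unfolding G_def using that sinR[of s] sin0[of s] by (auto intro!: K)
  obtain d y where y: "continuous_on {0..pi} y" "y pi = 0"
    "\<And>t. 0 \<le> t \<Longrightarrow> t \<le> pi \<Longrightarrow> y t = d * t + prim (prim (\<lambda>s. G (s, y s))) t"
  proof (rule dirichlet_solution[OF G K pi_gt_zero])
    fix d y assume "continuous_on {0..pi} y" "y pi = 0"
      "\<And>t. 0 \<le> t \<Longrightarrow> t \<le> pi \<Longrightarrow> y t = d * t + prim (prim (\<lambda>s. G (s, y s))) t"
    then show thesis by (rule that)
  qed
  have y0: "y 0 = 0" using y(3)[of 0] by simp
  have g0: "g (0, 0) = 0" using odd[of 0 0] by simp
  have gpi: "g (pi, 0) = 0" using odd[of pi 0] per[of "- pi" 0] by simp
  have "continuous_on {0..pi} (\<lambda>s. G (s, y s))"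
    by (intro continuous_on_compose2[OF G] continuous_intros y) auto
  then obtain w where w: "continuous_on UNIV w" "\<And>t. 0 \<le> t \<Longrightarrow> t \<le> pi \<Longrightarrow> w t = G (t, y t)"
    "\<And>t. w (- t) = -1 * w t" "\<And>t. w (t + 2 * pi) = w t"
    by (rule fold_extension[of _ "-1"]) (use r rR y0 y(2) g0 gpi in \<open>auto simp: G_def\<close>)
  define z where "z = (\<lambda>t. d * t + prim (prim w) t)"
  define v where "v = (\<lambda>t. d + prim w t)"
  have z: "(z has_real_derivative v t) (at t)" and v: "(v has_real_derivative w t) (at t)" for t
    unfolding z_def v_def using w(1)
    by (auto intro!: derivative_eq_intros DERIV_prim continuous_prim)
  have zy: "z t = y t" if "0 \<le> t" "t \<le> pi" for t
  proof -
    have "prim (prim w) t = prim (prim (\<lambda>s. G (s, y s))) t"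
      using that by (intro prim_cong) (auto intro!: w)
    then show ?thesis using y(3)[OF that] by (simp add: z_def)
  qed
  have z0: "z 0 = 0" "z pi = 0" using zy[of 0] zy[of pi] y0 y(2) by auto
  have zsym: "z (- t) = -1 * z t" "z (t + 2 * pi) = z t" for t
    using parity_and_period_of_forcing[OF z v w(3,4)] z0 by auto
  have w_eq: "w t = G (t, z t)" if "0 \<le> t" "t \<le> pi" for t
    using w(2) zy that by simp
  have zc: "continuous_on A z" for A
    using z by (meson DERIV_isCont continuous_at_imp_continuous_on)
  have lower: "r * sin t \<le> z t" if t: "0 \<le> t" "t \<le> pi" for t
  proof (rule ccontr)
    assume neg: "\<not> r * sin t \<le> z t"
    define u where "u = (\<lambda>t. z t - r * sin t)"
    have "\<exists>t0\<in>{0..pi}. \<forall>t\<in>{0..pi}. u t0 \<le> u t"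
      unfolding u_def by (intro continuous_attains_inf continuous_intros zc) auto
    then obtain t0 where t0: "t0 \<in> {0..pi}" "\<And>t. t \<in> {0..pi} \<Longrightarrow> u t0 \<le> u t" by blast
    have "u t0 < 0" using neg t0(2)[of t] t by (auto simp: u_def)
    then have "t0 \<noteq> 0" "t0 \<noteq> pi" by (auto simp: u_def z0)
    then have int: "0 < t0" "t0 < pi" using t0(1) by auto
    have "(u has_real_derivative v t - r * cos t) (at t)" for t
      unfolding u_def by (auto intro!: derivative_eq_intros z)
    moreover have "((\<lambda>t. v t - r * cos t) has_real_derivative w t0 + r * sin t0) (at t0)"
      by (auto intro!: derivative_eq_intros v)
    ultimately have "0 \<le> w t0 + r * sin t0"
      by (rule second_derivative_nonneg_at_local_min[of _ _ _ _ "min t0 (pi - t0)"])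
        (use int in \<open>auto intro!: t0(2) simp: abs_less_iff\<close>)
    moreover have "w t0 = g (t0, r * sin t0)"
      using int \<open>u t0 < 0\<close> sinR[of t0] by (simp add: w_eq G_def u_def min_def max_def)
    ultimately show False using lo[OF int] by simp
  qed
  have upper: "z t \<le> R" if t: "0 \<le> t" "t \<le> pi" for t
  proof (rule ccontr)
    assume big: "\<not> z t \<le> R"
    have "\<exists>t0\<in>{0..pi}. \<forall>t\<in>{0..pi}. z t \<le> z t0"
      by (intro continuous_attains_sup zc) auto
    then obtain t0 where t0: "t0 \<in> {0..pi}" "\<And>t. t \<in> {0..pi} \<Longrightarrow> z t \<le> z t0" by blast
    have "R < z t0" using big t0(2)[of t] t by auto
    then have "t0 \<noteq> 0" "t0 \<noteq> pi" using r rR by (auto simp: z0)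
    then have int: "0 < t0" "t0 < pi" using t0(1) by auto
    have "0 \<le> - w t0"
      by (rule second_derivative_nonneg_at_local_min[OF DERIV_minus[OF z] DERIV_minus[OF v],
            of "min t0 (pi - t0)"])
        (use int in \<open>auto intro!: t0(2) simp: abs_less_iff\<close>)
    moreover have "w t0 = g (t0, R)"
      using int \<open>R < z t0\<close> sinR[of t0] by (simp add: w_eq G_def min_def max_def)
    ultimately show False using hi[of t0] by simp
  qed
  have "w t = g (t, z t)" for t
  proof (rule eq_if_same_parity[where f = w and g = "\<lambda>t. g (t, z t)", OF w(3,4)])
    show "w t = g (t, z t)" if "0 \<le> t" "t \<le> pi" for t
      using lower[OF that] upper[OF that] by (simp add: w_eq[OF that] G_def min_def max_def)
  qed (use zsym per odd in auto)
  then show ?thesis using that[of z v] z v zsym lower by simp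
qed

section \<open>Solutions with a fixed direction\<close>

text \<open>
  The orbit of \<open>t \<mapsto> z t *\<^sub>R e\<close> when \<open>z\<close> has period \<open>2 * pi\<close> and is even or odd: time shifts then act
  trivially and reflection in time by a sign.
\<close>

definition profiles :: "(real \<Rightarrow> real) \<Rightarrow> real^3 \<Rightarrow> (real \<Rightarrow> real^3) set" where
  "profiles z e = {\<lambda>t. z t *\<^sub>R (s *\<^sub>R perm_vec \<sigma> e) | s \<sigma>. s \<in> {1, -1} \<and> bij \<sigma>}"

lemma perm_vec_scaleR: "perm_vec \<sigma> (a *\<^sub>R x) = a *\<^sub>R perm_vec \<sigma> x"
  by (simp add: perm_vec_def vec_eq_iff)

lemma carrier_SymG: "carrier SymG = {\<sigma>. bij \<sigma>} \<times> (({0..<3} \<times> UNIV) \<times> {1, -1})"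
  by (simp add: SymG_def Perm3_def Dih3_def Sgn_def DirProd_def)

lemma conjugate_in_refl:
  assumes "H \<subseteq> carrier SymG"
  shows "conjugate_in SymG H H"
proof -
  interpret group SymG by (rule group_SymG)
  have "H = \<one>\<^bsub>SymG\<^esub> <#\<^bsub>SymG\<^esub> H #>\<^bsub>SymG\<^esub> inv\<^bsub>SymG\<^esub> \<one>\<^bsub>SymG\<^esub>"
    using assms by (simp add: coset_mult_one lcos_mult_one)
  then show ?thesis unfolding conjugate_in_def by blast
qed

lemma finite_profiles: "finite (profiles z e)"
proof -
  have "profiles z e \<subseteq> (\<lambda>(s, \<sigma>) t. z t *\<^sub>R (s *\<^sub>R perm_vec \<sigma> e)) ` ({1, -1} \<times> UNIV)"
    unfolding profiles_def by auto
  then show ?thesis by (rule finite_subset) simp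
qed

lemma card_le_card_profiles:
  assumes "z t0 \<noteq> 0" and "\<And>c. c \<in> C \<Longrightarrow> \<exists>s \<sigma>. c = s *\<^sub>R perm_vec \<sigma> e \<and> s \<in> {1, -1} \<and> bij \<sigma>"
  shows "card C \<le> card (profiles z e)"
proof -
  have "inj_on (\<lambda>c t. z t *\<^sub>R c) C"
    using assms(1) by (auto intro!: inj_onI dest: fun_cong[of _ _ t0])
  moreover have "(\<lambda>c t. z t *\<^sub>R c) ` C \<subseteq> profiles z e"
    unfolding profiles_def using assms(2) by blast
  ultimately show ?thesis using card_inj_on_le finite_profiles by blast
qed

locale symmetric_system =
  fixes f :: "real \<times> (real^3) \<Rightarrow> real^3"
  assumes cont: "continuous_on UNIV f"
    and per: "\<And>t x. f (t + 2 * pi, x) = f (t, x)"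
    and even: "\<And>t x. f (- t, x) = f (t, x)"
    and odd: "\<And>t x. f (t, - x) = - f (t, x)"
    and equivariant: "\<And>t x \<sigma>. bij \<sigma> \<Longrightarrow> f (t, perm_vec \<sigma> x) = perm_vec \<sigma> (f (t, x))"
begin

lemma scaled_profile_solution:
  assumes z: "\<And>t. (z has_real_derivative v t) (at t)" and v: "\<And>t. (v has_real_derivative w t) (at t)"
    and zper: "\<And>t. z (t + 2 * pi) = z t" and f: "\<And>t. f (t, z t *\<^sub>R e) = w t *\<^sub>R e"
  shows "(\<lambda>t. z t *\<^sub>R e) \<in> solutions f"
proof -
  have dz: "((\<lambda>t. z t *\<^sub>R e) has_vector_derivative v t *\<^sub>R e) (at t)" for t
    using z by (auto intro!: derivative_eq_intros simp: has_real_derivative_iff_has_vector_derivative)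
  have dv: "((\<lambda>t. v t *\<^sub>R e) has_vector_derivative f (t, z t *\<^sub>R e)) (at t)" for t
    using v by (auto intro!: derivative_eq_intros simp: has_real_derivative_iff_has_vector_derivative f)
  have zc: "continuous_on UNIV z"
    using z by (meson DERIV_isCont continuous_at_imp_continuous_on)
  have "continuous_on UNIV (\<lambda>t. f (t, z t *\<^sub>R e))"
    by (intro continuous_on_compose2[OF cont] continuous_intros zc) auto
  then have "(\<lambda>t. v t *\<^sub>R e) C1_differentiable_on UNIV"
    unfolding C1_differentiable_on_def using dv by (intro exI[of _ "\<lambda>t. f (t, z t *\<^sub>R e)"]) auto
  moreover have "z (t + 6 * pi) = z t" for t
    using zper[of t] zper[of "t + 2 * pi"] zper[of "t + 2 * pi + 2 * pi"] by (simp add: algebra_simps)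
  ultimately show ?thesis
    unfolding solutions_def C2_periodic_def using dz dv
    by (auto intro!: exI[of _ "\<lambda>t. v t *\<^sub>R e"])
qed

text \<open>
  The parity \<open>p\<close> of \<open>z\<close> is the sign by which reflection in time acts. A group element fixes
  \<open>t \<mapsto> z t *\<^sub>R e\<close> exactly if its combined sign and permutation fix the vector \<open>e\<close>, because
  \<open>z\<close> does not vanish identically.
\<close>

lemma profile_orbit:
  assumes z: "\<And>t. (z has_real_derivative v t) (at t)" and v: "\<And>t. (v has_real_derivative w t) (at t)"
    and zsym: "\<And>t. z (- t) = p * z t" "\<And>t. z (t + 2 * pi) = z t" and p: "p \<in> {1, -1}"
    and f: "\<And>t. f (t, z t *\<^sub>R e) = w t *\<^sub>R e" and nz: "z t0 \<noteq> 0"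
    and H: "H = {(\<sigma>, (j, r), s). bij \<sigma> \<and> j \<in> {0..<3} \<and> s \<in> {1, -1} \<and>
      ((if r then p else 1) * s) *\<^sub>R perm_vec \<sigma> e = e}"
  shows "profiles z e \<in> solution_orbits H f" "profiles z e \<subseteq> solutions f"
proof -
  define u where "u = (\<lambda>t. z t *\<^sub>R e)"
  have usol: "u \<in> solutions f"
    unfolding u_def by (rule scaled_profile_solution[OF z v zsym(2) f])
  then have uC: "u \<in> C2_periodic" by (simp add: solutions_def)
  interpret z: periodic_fun_simple z "2 * pi" by unfold_locales (rule zsym)
  have zt: "z (time_map (j, r) t) = (if r then p else 1) * z t" for j r t
    using z.plus_of_int[of t j] zsym(1)[of "t + of_int j * (2 * pi)"] by (simp add: mult.commute)
  have act: "act (\<sigma>, (j, r), s) u = (\<lambda>t. z t *\<^sub>R (((if r then p else 1) * s) *\<^sub>R perm_vec \<sigma> e))" for \<sigma> j r s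
    using uC unfolding act_def
    by (simp add: u_def zt perm_vec_scaleR mult_ac del: time_map.simps)
  have "orbit SymG act u = profiles z e"
  proof
    show "orbit SymG act u \<subseteq> profiles z e"
    proof
      fix x assume "x \<in> orbit SymG act u"
      then obtain \<sigma> j r s where g: "(\<sigma>, (j, r), s) \<in> carrier SymG" and x: "x = act (\<sigma>, (j, r), s) u"
        unfolding orbit_def by auto
      have "(if r then p else 1) * s \<in> {1, -1}" "bij \<sigma>"
        using g p by (auto simp: carrier_SymG)
      then show "x \<in> profiles z e" unfolding x act profiles_def by blast
    qed
    show "profiles z e \<subseteq> orbit SymG act u"
    proof
      fix x assume "x \<in> profiles z e"
      then obtain s \<sigma> where x: "x = (\<lambda>t. z t *\<^sub>R (s *\<^sub>R perm_vec \<sigma> e))" "s \<in> {1, -1}" "bij \<sigma>"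
        unfolding profiles_def by blast
      then have "x = act (\<sigma>, (0, False), s) u" "(\<sigma>, (0, False), s) \<in> carrier SymG"
        by (auto simp: act carrier_SymG)
      then show "x \<in> orbit SymG act u" unfolding orbit_def by blast
    qed
  qed
  moreover have "stabilizer SymG act u = H"
  proof -
    have "act (\<sigma>, (j, r), s) u = u \<longleftrightarrow> ((if r then p else 1) * s) *\<^sub>R perm_vec \<sigma> e = e" for \<sigma> j r s
    proof
      assume fixed: "act (\<sigma>, (j, r), s) u = u"
      have "z t0 *\<^sub>R (((if r then p else 1) * s) *\<^sub>R perm_vec \<sigma> e) = act (\<sigma>, (j, r), s) u t0"
        by (simp only: act)
      also have "\<dots> = z t0 *\<^sub>R e" by (simp only: fixed) (simp only: u_def)
      finally show "((if r then p else 1) * s) *\<^sub>R perm_vec \<sigma> e = e"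
        by (rule scaleR_left_imp_eq[OF nz])
    qed (simp only: act, simp add: u_def)
    then show ?thesis unfolding stabilizer_def carrier_SymG H by auto
  qed
  moreover have "H \<subseteq> carrier SymG" unfolding H carrier_SymG by auto
  ultimately show "profiles z e \<in> solution_orbits H f"
    unfolding solution_orbits_def using usol conjugate_in_refl by auto
  show "profiles z e \<subseteq> solutions f"
  proof
    fix x assume "x \<in> profiles z e"
    then obtain s \<sigma> where x: "x = (\<lambda>t. z t *\<^sub>R (s *\<^sub>R perm_vec \<sigma> e))" "s \<in> {1, -1}" "bij \<sigma>"
      unfolding profiles_def by blast
    have eq: "f (t, z t *\<^sub>R perm_vec \<sigma> e) = w t *\<^sub>R perm_vec \<sigma> e" for t
      using equivariant[OF x(3), of t "z t *\<^sub>R e"] by (simp add: f perm_vec_scaleR)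
    have "f (t, z t *\<^sub>R (s *\<^sub>R perm_vec \<sigma> e)) = w t *\<^sub>R (s *\<^sub>R perm_vec \<sigma> e)" for t
      using x(2) odd[of t "z t *\<^sub>R perm_vec \<sigma> e"] by (auto simp: eq)
    then show "x \<in> solutions f"
      unfolding x(1) by (rule scaled_profile_solution[OF z v zsym(2)])
  qed
qed

end

locale bistable_system = symmetric_system +
  assumes linearization: "uniform_limit UNIV (\<lambda>x t. (f (t, x) - matA *v x) /\<^sub>R norm x) (\<lambda>t. 0) (at 0)"
    and coercive: "\<exists>M>0. \<forall>t x. norm x \<ge> M \<longrightarrow> f (t, x) \<bullet> x > 0"
begin

text \<open>
  On a line that \<open>f\<close> maps into itself the system becomes a scalar equation \<open>z'' = g(t, z)\<close>, where \<open>g\<close>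
  inherits the symmetries, is positive for large arguments by coercivity, and has slope \<open>\<mu>\<close> at the origin.
\<close>

lemma scalar_reduction:
  assumes e: "e \<noteq> 0" "matA *v e = \<mu> *\<^sub>R e" and line: "\<And>t x. \<exists>y. f (t, x *\<^sub>R e) = y *\<^sub>R e"
  obtains g :: "real \<times> real \<Rightarrow> real" where "continuous_on UNIV g" "\<And>t x. f (t, x *\<^sub>R e) = g (t, x) *\<^sub>R e"
    "\<And>t x. g (t + 2 * pi, x) = g (t, x)" "\<And>t x. g (- t, x) = g (t, x)" "\<And>t x. g (t, - x) = - g (t, x)"
    "\<exists>R0>0. \<forall>R\<ge>R0. \<forall>t. 0 < g (t, R)"
    "\<And>\<eta>. 0 < \<eta> \<Longrightarrow> \<exists>\<delta>>0. \<forall>t x. \<bar>x\<bar> < \<delta> \<longrightarrow> x \<noteq> 0 \<longrightarrow> \<bar>g (t, x) - \<mu> * x\<bar> < \<eta> * \<bar>x\<bar>"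
proof -
  define g where "g = (\<lambda>(t, x). (f (t, x *\<^sub>R e) \<bullet> e) / (e \<bullet> e))"
  have ee: "0 < e \<bullet> e" using e(1) by simp
  have fe: "f (t, x *\<^sub>R e) = g (t, x) *\<^sub>R e" for t x
    using line[of t x] e(1) by (auto simp: g_def)
  show ?thesis
  proof (rule that[OF _ fe])
    show "continuous_on UNIV g"
      unfolding g_def split_beta using e(1)
      by (intro continuous_intros continuous_on_compose2[OF cont]) auto
    show "g (t + 2 * pi, x) = g (t, x)" "g (- t, x) = g (t, x)" for t x
      by (simp_all add: g_def per even)
    show "g (t, - x) = - g (t, x)" for t x
      by (simp add: g_def odd)
    obtain M where M: "M > 0" "\<And>t x. norm x \<ge> M \<Longrightarrow> f (t, x) \<bullet> x > 0"
      using coercive by blast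
    show "\<exists>R0>0. \<forall>R\<ge>R0. \<forall>t. 0 < g (t, R)"
    proof (intro exI conjI allI impI)
      show R0: "0 < M / norm e" using M e by simp
      fix R t assume R: "M / norm e \<le> R"
      then have Rpos: "0 < R" using R0 by linarith
      then have "M \<le> norm (R *\<^sub>R e)" using R e(1) by (simp add: field_simps)
      from M(2)[OF this, of t] have "0 < (g (t, R) * R) * (e \<bullet> e)" by (simp add: fe mult_ac)
      then show "0 < g (t, R)" using ee Rpos by (simp add: zero_less_mult_iff)
    qed
    fix \<eta> :: real assume \<eta>: "0 < \<eta>"
    obtain d where d: "d > 0" "\<And>x t. x \<noteq> 0 \<Longrightarrow> norm x < d \<Longrightarrow> norm ((f (t, x) - matA *v x) /\<^sub>R norm x) < \<eta>"
      using uniform_limitD[OF linearization \<eta>] by (auto simp: eventually_at dist_norm)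
    show "\<exists>\<delta>>0. \<forall>t x. \<bar>x\<bar> < \<delta> \<longrightarrow> x \<noteq> 0 \<longrightarrow> \<bar>g (t, x) - \<mu> * x\<bar> < \<eta> * \<bar>x\<bar>"
    proof (intro exI conjI allI impI)
      show "0 < d / norm e" using d e by simp
      fix t x :: real assume x: "\<bar>x\<bar> < d / norm e" "x \<noteq> 0"
      have "norm (x *\<^sub>R e) < d" using x e(1) by (simp add: field_simps)
      then have "norm ((f (t, x *\<^sub>R e) - matA *v (x *\<^sub>R e)) /\<^sub>R norm (x *\<^sub>R e)) < \<eta>"
        using x e(1) by (intro d) auto
      moreover define k where "k = g (t, x) - \<mu> * x"
      have "f (t, x *\<^sub>R e) - matA *v (x *\<^sub>R e) = k *\<^sub>R e"
        by (simp add: fe matrix_vector_mult_scaleR e(2) algebra_simps k_def)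
      ultimately have "\<bar>k\<bar> < \<eta> * \<bar>x\<bar>"
        using x e(1) by (simp add: field_simps)
      then show "\<bar>g (t, x) - \<mu> * x\<bar> < \<eta> * \<bar>x\<bar>" by (simp add: k_def)
    qed
  qed
qed

text \<open>
  For \<open>\<mu> < 0\<close> a small positive constant is a lower solution and a large one an upper solution.
\<close>

lemma even_profile:
  assumes e: "e \<noteq> 0" "matA *v e = \<mu> *\<^sub>R e" and line: "\<And>t x. \<exists>y. f (t, x *\<^sub>R e) = y *\<^sub>R e"
    and \<mu>: "\<mu> < 0"
    and H: "H = {(\<sigma>, (j, r), s). bij \<sigma> \<and> j \<in> {0..<3} \<and> s \<in> {1, -1} \<and> s *\<^sub>R perm_vec \<sigma> e = e}"
  obtains z where "\<And>t. z (- t) = z t" "\<And>t. 0 < z t"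
    "profiles z e \<in> solution_orbits H f" "profiles z e \<subseteq> solutions f"
proof -
  obtain g where g: "continuous_on UNIV g" "\<And>t x. f (t, x *\<^sub>R e) = g (t, x) *\<^sub>R e"
    "\<And>t x. g (t + 2 * pi, x) = g (t, x)" "\<And>t x. g (- t, x) = g (t, x)" "\<And>t x. g (t, - x) = - g (t, x)"
    and hi: "\<exists>R0>0. \<forall>R\<ge>R0. \<forall>t. 0 < g (t, R)"
    and lo: "\<And>\<eta>. 0 < \<eta> \<Longrightarrow> \<exists>\<delta>>0. \<forall>t x. \<bar>x\<bar> < \<delta> \<longrightarrow> x \<noteq> 0 \<longrightarrow> \<bar>g (t, x) - \<mu> * x\<bar> < \<eta> * \<bar>x\<bar>"
    by (rule scalar_reduction[OF e line]) (erule that; blast)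
  obtain R0 where R0: "\<And>R t. R0 \<le> R \<Longrightarrow> 0 < g (t, R)" using hi by blast
  obtain \<delta> where \<delta>: "0 < \<delta>" "\<And>t x. \<bar>x\<bar> < \<delta> \<Longrightarrow> x \<noteq> 0 \<Longrightarrow> \<bar>g (t, x) - \<mu> * x\<bar> < - \<mu> * \<bar>x\<bar>"
    using lo[of "- \<mu>"] \<mu> by auto
  have below: "g (t, \<delta> / 2) < 0" for t
    using \<delta>(2)[of "\<delta> / 2" t] \<delta>(1) by (auto simp: abs_less_iff)
  have above: "0 < g (t, max R0 (\<delta> / 2))" for t by (rule R0) simp
  obtain z v where z: "\<And>t. (z has_real_derivative v t) (at t)"
    "\<And>t. (v has_real_derivative g (t, z t)) (at t)"
    "\<And>t. z (- t) = z t" "\<And>t. z (t + 2 * pi) = z t" "\<And>t. \<delta> / 2 \<le> z t"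
    "\<And>t. z t \<le> max R0 (\<delta> / 2)"
    using even_periodic_solution[OF g(1,3,4) below above max.cobounded2] by metis
  have pos: "0 < z t" for t using z(5)[of t] \<delta>(1) by linarith
  show ?thesis
  proof (rule that[of z])
    show "profiles z e \<in> solution_orbits H f" "profiles z e \<subseteq> solutions f"
      by (rule profile_orbit[OF z(1,2) _ z(4), of 1 e 0 H]; use z(3) pos[of 0] g(2) H in simp)+
  qed (use z(3) pos in auto)
qed

text \<open>
  The function \<open>sin\<close> is the first Dirichlet eigenfunction of \<open>- z''\<close> on \<open>[0, pi]\<close>, with eigenvalue \<open>1\<close>.
  So a small multiple of it is a lower solution as soon as \<open>- \<mu> > 1\<close>.
\<close>

lemma odd_profile:
  assumes e: "e \<noteq> 0" "matA *v e = \<mu> *\<^sub>R e" and line: "\<And>t x. \<exists>y. f (t, x *\<^sub>R e) = y *\<^sub>R e"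
    and \<mu>: "\<mu> < -1"
    and H: "H = {(\<sigma>, (j, r), s). bij \<sigma> \<and> j \<in> {0..<3} \<and> s \<in> {1, -1} \<and>
      ((if r then -1 else 1) * s) *\<^sub>R perm_vec \<sigma> e = e}"
  obtains z where "\<And>t. z (- t) = - z t" "0 < z (pi / 2)"
    "profiles z e \<in> solution_orbits H f" "profiles z e \<subseteq> solutions f"
proof -
  obtain g where g: "continuous_on UNIV g" "\<And>t x. f (t, x *\<^sub>R e) = g (t, x) *\<^sub>R e"
    "\<And>t x. g (t + 2 * pi, x) = g (t, x)" "\<And>t x. g (- t, x) = g (t, x)" "\<And>t x. g (t, - x) = - g (t, x)"
    and hi: "\<exists>R0>0. \<forall>R\<ge>R0. \<forall>t. 0 < g (t, R)"
    and lo: "\<And>\<eta>. 0 < \<eta> \<Longrightarrow> \<exists>\<delta>>0. \<forall>t x. \<bar>x\<bar> < \<delta> \<longrightarrow> x \<noteq> 0 \<longrightarrow> \<bar>g (t, x) - \<mu> * x\<bar> < \<eta> * \<bar>x\<bar>"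
    by (rule scalar_reduction[OF e line]) (erule that; blast)
  obtain R0 where R0: "\<And>R t. R0 \<le> R \<Longrightarrow> 0 < g (t, R)" using hi by blast
  obtain \<delta> where \<delta>: "0 < \<delta>" "\<And>t x. \<bar>x\<bar> < \<delta> \<Longrightarrow> x \<noteq> 0 \<Longrightarrow> \<bar>g (t, x) - \<mu> * x\<bar> < (- 1 - \<mu>) * \<bar>x\<bar>"
    using lo[of "- 1 - \<mu>"] \<mu> by auto
  have below: "g (t, \<delta> / 2 * sin t) < - (\<delta> / 2) * sin t" if "0 < t" "t < pi" for t
  proof -
    have s: "0 < \<delta> / 2 * sin t" using that \<delta>(1) by (simp add: sin_gt_zero)
    have "\<delta> / 2 * sin t \<le> \<delta> / 2 * 1" using \<delta>(1) by (intro mult_left_mono) auto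
    then have "\<delta> / 2 * sin t < \<delta>" using \<delta>(1) by linarith
    moreover have "g (t, x) < - x" if x: "0 < x" "x < \<delta>" for x
      using \<delta>(2)[of x t] x by (simp add: abs_less_iff algebra_simps)
    ultimately show ?thesis using s by force
  qed
  have \<delta>2: "0 < \<delta> / 2" using \<delta>(1) by simp
  have above: "0 < g (t, max R0 (\<delta> / 2))" for t by (rule R0) simp
  have godd: "g (- t, - x) = - g (t, x)" for t x by (simp add: g(4,5))
  obtain z v where z: "\<And>t. (z has_real_derivative v t) (at t)"
    "\<And>t. (v has_real_derivative g (t, z t)) (at t)"
    "\<And>t. z (- t) = - z t" "\<And>t. z (t + 2 * pi) = z t" "\<And>t. 0 \<le> t \<Longrightarrow> t \<le> pi \<Longrightarrow> \<delta> / 2 * sin t \<le> z t"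
  proof (rule odd_periodic_solution[OF g(1,3) godd below above \<delta>2 max.cobounded2])
    fix z v assume "\<And>t. (z has_real_derivative v t) (at t)"
      "\<And>t. (v has_real_derivative g (t, z t)) (at t)" "\<And>t. z (- t) = - z t"
      "\<And>t. z (t + 2 * pi) = z t" "\<And>t. 0 \<le> t \<Longrightarrow> t \<le> pi \<Longrightarrow> \<delta> / 2 * sin t \<le> z t"
    then show thesis by (rule that)
  qed
  have pos: "0 < z (pi / 2)" using z(5)[of "pi / 2"] \<delta>(1) by auto
  show ?thesis
  proof (rule that[of z])
    show "profiles z e \<in> solution_orbits H f" "profiles z e \<subseteq> solutions f"
      by (rule profile_orbit[OF z(1,2) _ z(4), of "-1" e "pi / 2" H]; use z(3) pos g(2) H in simp)+
  qed (use z(3) pos in auto)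
qed

end

section \<open>The two eigendirections and their isotropy groups\<close>

definition diag3 :: "real^3" where "diag3 = vector [1, 1, 1]"

definition anti3 :: "real^3" where "anti3 = vector [0, 1, -1]"

lemma diag3_nth [simp]: "diag3 $ i = 1"
  using exhaust_3[of i] by (auto simp: diag3_def)

lemma anti3_nth [simp]: "anti3 $ 1 = 0" "anti3 $ 2 = 1" "anti3 $ 3 = -1"
  by (simp_all add: anti3_def)

lemma matA_diag3: "matA *v diag3 = (-2) *\<^sub>R diag3"
  by (simp add: matA_def vec_eq_iff forall_3 matrix_vector_mult_def sum_3)

lemma matA_anti3: "matA *v anti3 = (-1/2) *\<^sub>R anti3"
  by (simp add: matA_def vec_eq_iff forall_3 matrix_vector_mult_def sum_3)

lemma perm_vec_diag3 [simp]: "perm_vec \<sigma> diag3 = diag3"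
  by (simp add: perm_vec_def vec_eq_iff)

lemma tau_simps [simp]: "tau 1 = 1" "tau 2 = 3" "tau 3 = 2" "bij tau"
  by (simp_all add: tau_def Transposition.transpose_def)

lemma H_D3_D3_eq: "H_D3_D3 = {(\<sigma>, (j, r), s). bij \<sigma> \<and> j \<in> {0..<3} \<and> s \<in> {1, -1} \<and>
    s *\<^sub>R perm_vec \<sigma> diag3 = diag3}"
  by (auto simp: H_D3_D3_def Perm3_def Dih3_def vec_eq_iff)

lemma D3z_eq: "D3z = {((j, r), s). j \<in> {0..<3} \<and> s = (if r then -1 else 1)}" (is "_ = ?K")
proof
  let ?D = "Dih3 \<times>\<times> Sgn"
  have gD: "group ?D" by (intro DirProd_group group_Dih3 group_Sgn)
  have inv_g: "inv\<^bsub>?D\<^esub> (dih_gamma, 1) = ((2, False), 1)"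
    by (rule group.inv_equality[OF gD]) (simp_all add: Dih3_def Sgn_def dih_gamma_def)
  have inv_k: "inv\<^bsub>?D\<^esub> (dih_kappa, -1) = ((0, True), -1)"
    by (rule group.inv_equality[OF gD]) (simp_all add: Dih3_def Sgn_def dih_kappa_def)
  show "D3z \<subseteq> ?K"
  proof
    fix x assume "x \<in> D3z"
    then show "x \<in> ?K" unfolding D3z_def
    proof induction
      case one
      then show ?case by (simp add: Dih3_def Sgn_def)
    next
      case (incl h)
      then show ?case by (auto simp: dih_gamma_def dih_kappa_def)
    next
      case (inv h)
      then show ?case by (auto simp: inv_g inv_k)
    next
      case (eng h1 h2)
      obtain j r where "h1 = ((j, r), if r then -1 else 1)" using eng.IH(1) by auto
      moreover obtain k q where "h2 = ((k, q), if q then -1 else 1)" using eng.IH(2) by auto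
      ultimately show ?case by (simp add: Dih3_def Sgn_def)
    qed
  qed
  have g: "((1, False), 1) \<in> D3z" and k: "((0, True), -1) \<in> D3z"
    unfolding D3z_def by (auto intro!: generate.incl simp: dih_gamma_def dih_kappa_def)
  have m: "x \<otimes>\<^bsub>?D\<^esub> y \<in> D3z" if "x \<in> D3z" "y \<in> D3z" for x y
    using that unfolding D3z_def by (rule generate.eng)
  have g0: "((0, False), 1) \<in> D3z"
    using generate.one[of ?D] by (simp add: D3z_def Dih3_def Sgn_def)
  have g2: "((2, False), 1) \<in> D3z" using m[OF g g] by (simp add: Dih3_def Sgn_def)
  show "?K \<subseteq> D3z"
  proof clarsimp
    fix j :: int and r assume "0 \<le> j" "j < 3"
    then have "j = 0 \<or> j = 1 \<or> j = 2" by auto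
    then have "((j, False), 1) \<in> D3z" using g0 g g2 by auto
    moreover from m[OF this k] have "((j, True), -1) \<in> D3z"
      using \<open>0 \<le> j\<close> \<open>j < 3\<close> by (simp add: Dih3_def Sgn_def)
    ultimately show "(r \<longrightarrow> ((j, True), - 1) \<in> D3z) \<and> (\<not> r \<longrightarrow> ((j, False), 1) \<in> D3z)" by simp
  qed
qed

lemma H_D3_D3z_eq: "H_D3_D3z = {(\<sigma>, (j, r), s). bij \<sigma> \<and> j \<in> {0..<3} \<and> s \<in> {1, -1} \<and>
    ((if r then -1 else 1) * s) *\<^sub>R perm_vec \<sigma> diag3 = diag3}"
  by (auto simp: H_D3_D3z_def D3z_eq Perm3_def vec_eq_iff)

text \<open>
  The only zero of \<^const>\<open>anti3\<close> is its first entry, so \<open>\<sigma>\<close> fixes \<open>1\<close> and either fixes or exchanges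
  \<open>2\<close> and \<open>3\<close>.
\<close>

lemma perm_vec_anti3_eq_iff:
  assumes "bij \<sigma>"
  shows "perm_vec \<sigma> anti3 = anti3 \<longleftrightarrow> \<sigma> = id" "- perm_vec \<sigma> anti3 = anti3 \<longleftrightarrow> \<sigma> = tau"
proof -
  have "\<sigma> 1 \<noteq> \<sigma> 2" "\<sigma> 1 \<noteq> \<sigma> 3" "\<sigma> 2 \<noteq> \<sigma> 3"
    using assms by (simp_all add: bij_is_inj inj_eq)
  then show "perm_vec \<sigma> anti3 = anti3 \<longleftrightarrow> \<sigma> = id" "- perm_vec \<sigma> anti3 = anti3 \<longleftrightarrow> \<sigma> = tau"
    using exhaust_3[of "\<sigma> 1"] exhaust_3[of "\<sigma> 2"] exhaust_3[of "\<sigma> 3"]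
    by (auto simp: vec_eq_iff forall_3 perm_vec_def fun_eq_iff)
qed

lemma H_D1_D3p_eq: "H_D1_D3p = {(\<sigma>, (j, r), s). bij \<sigma> \<and> j \<in> {0..<3} \<and> s \<in> {1, -1} \<and>
    s *\<^sub>R perm_vec \<sigma> anti3 = anti3}"
  unfolding H_D1_D3p_explicit by (auto simp: perm_vec_anti3_eq_iff Dih3_def)

lemma card_profiles_diag3:
  assumes "z t0 \<noteq> 0"
  shows "2 \<le> card (profiles z diag3)"
proof -
  have "card {diag3, - diag3} \<le> card (profiles z diag3)"
  proof (rule card_le_card_profiles[of z t0])
    fix c assume "c \<in> {diag3, - diag3}"
    then have "c = 1 *\<^sub>R perm_vec id diag3 \<or> c = -1 *\<^sub>R perm_vec id diag3" by auto
    then show "\<exists>s \<sigma>. c = s *\<^sub>R perm_vec \<sigma> diag3 \<and> s \<in> {1, -1} \<and> bij \<sigma>" by blast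
  qed (rule assms)
  moreover have "diag3 \<noteq> - diag3" by (simp add: vec_eq_iff)
  ultimately show ?thesis by simp
qed

lemma card_profiles_anti3:
  assumes "z t0 \<noteq> 0"
  shows "6 \<le> card (profiles z anti3)"
proof -
  \<comment> \<open>The transposition \<open>(1 j)\<close> moves the zero entry to place \<open>j\<close>.\<close>
  let ?p = "\<lambda>s i j. s *\<^sub>R perm_vec (Transposition.transpose i j) anti3"
  define C where "C = {?p 1 1 1, ?p (-1) 1 1, ?p 1 1 2, ?p (-1) 1 2, ?p 1 1 3, ?p (-1) 1 3}"
  have p: "?p 1 1 1 = vector [0, 1, -1]" "?p (-1) 1 1 = vector [0, -1, 1]"
    "?p 1 1 2 = vector [1, 0, -1]" "?p (-1) 1 2 = vector [-1, 0, 1]"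
    "?p 1 1 3 = vector [-1, 1, 0]" "?p (-1) 1 3 = vector [1, -1, 0]"
    by (simp_all add: vec_eq_iff forall_3 perm_vec_def Transposition.transpose_def)
  have "card C = 6"
    unfolding C_def p by (simp add: vec_eq_iff forall_3)
  moreover have "card C \<le> card (profiles z anti3)"
  proof (rule card_le_card_profiles[of z t0])
    fix c assume "c \<in> C"
    then obtain s i j where "c = ?p s i j" "s \<in> {1, -1}" unfolding C_def by blast
    then show "\<exists>s \<sigma>. c = s *\<^sub>R perm_vec \<sigma> anti3 \<and> s \<in> {1, -1} \<and> bij \<sigma>"
      by (intro exI[of _ s] exI[of _ "Transposition.transpose i j"]) simp
  qed (rule assms)
  ultimately show ?thesis by simp
qed

theorem theorem2p14:
  fixes f :: "real \<times> (real^3) \<Rightarrow> real^3"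
  assumes "continuous_on UNIV f"
    and "\<And>t x. f (t + 2 * pi, x) = f (t, x)"
    and "\<And>t x. f (- t, x) = f (t, x)"
    and "\<And>t x. f (t, - x) = - f (t, x)"
    and "\<And>t x \<sigma>. \<sigma> \<in> carrier Perm3 \<Longrightarrow> f (t, perm_vec \<sigma> x) = perm_vec \<sigma> (f (t, x))"
    and "uniform_limit UNIV (\<lambda>x t. (f (t, x) - matA *v x) /\<^sub>R norm x) (\<lambda>t. 0) (at 0)"
    and "\<exists>M>0. \<forall>t x. norm x \<ge> M \<longrightarrow> f (t, x) \<bullet> x > 0"
  shows "(\<exists>B \<in> solution_orbits H_D1_D3p f. B \<subseteq> solutions f \<and> card B \<ge> 6)
    \<and> (\<exists>B \<in> solution_orbits H_D3_D3z f. B \<subseteq> solutions f \<and> card B \<ge> 2)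
    \<and> (\<exists>B \<in> solution_orbits H_D3_D3 f. B \<subseteq> solutions f \<and> card B \<ge> 2)
    \<and> (\<exists>S \<subseteq> solutions f. finite S \<and> card S \<ge> 10)"
proof -
  interpret bistable_system f
    using assms by unfold_locales (auto simp: Perm3_def)
  \<comment> \<open>The two lines are fixed spaces: of all permutations, and of \<open>tau\<close> composed with \<open>- 1\<close>.\<close>
  have diag_line: "\<exists>y. f (t, x *\<^sub>R diag3) = y *\<^sub>R diag3" for t x
  proof
    have "f (t, x *\<^sub>R diag3) $ i = f (t, x *\<^sub>R diag3) $ 1" for i
      using equivariant[of "Transposition.transpose 1 i" t "x *\<^sub>R diag3"]
      by (simp add: perm_vec_scaleR) (simp add: perm_vec_def vec_eq_iff, metis transpose_apply_second)
    then show "f (t, x *\<^sub>R diag3) = (f (t, x *\<^sub>R diag3) $ 1) *\<^sub>R diag3"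
      by (simp add: vec_eq_iff)
  qed
  have anti_line: "\<exists>y. f (t, x *\<^sub>R anti3) = y *\<^sub>R anti3" for t x
  proof
    have "perm_vec tau (x *\<^sub>R anti3) = - (x *\<^sub>R anti3)"
      by (simp add: perm_vec_def vec_eq_iff forall_3)
    then have "perm_vec tau (f (t, x *\<^sub>R anti3)) = - f (t, x *\<^sub>R anti3)"
      using equivariant[of tau t "x *\<^sub>R anti3"] odd[of t "x *\<^sub>R anti3"] by simp
    then have "perm_vec tau (f (t, x *\<^sub>R anti3)) $ i = - f (t, x *\<^sub>R anti3) $ i" for i by simp
    from this[of 1] this[of 2] show "f (t, x *\<^sub>R anti3) = (f (t, x *\<^sub>R anti3) $ 2) *\<^sub>R anti3"
      by (simp add: perm_vec_def vec_eq_iff forall_3)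
  qed
  have diag0: "diag3 \<noteq> 0" by (simp add: vec_eq_iff)
  have anti0: "anti3 \<noteq> 0" by (auto simp: vec_eq_iff forall_3)
  have neg: "-1/2 < (0::real)" "-2 < (0::real)" "-2 < (-1::real)" by simp_all
  obtain z1 where z1: "\<And>t. 0 < z1 t"
    "profiles z1 anti3 \<in> solution_orbits H_D1_D3p f" "profiles z1 anti3 \<subseteq> solutions f"
    using even_profile[OF anti0 matA_anti3 anti_line neg(1) H_D1_D3p_eq] by metis
  obtain z2 where z2: "\<And>t. z2 (- t) = - z2 t" "0 < z2 (pi / 2)"
    "profiles z2 diag3 \<in> solution_orbits H_D3_D3z f" "profiles z2 diag3 \<subseteq> solutions f"
    using odd_profile[OF diag0 matA_diag3 diag_line neg(3) H_D3_D3z_eq] by metis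
  obtain z3 where z3: "\<And>t. z3 (- t) = z3 t" "\<And>t. 0 < z3 t"
    "profiles z3 diag3 \<in> solution_orbits H_D3_D3 f" "profiles z3 diag3 \<subseteq> solutions f"
    using even_profile[OF diag0 matA_diag3 diag_line neg(2) H_D3_D3_eq] by metis
  \<comment> \<open>Values on the diagonal tell the second and third orbit from the first, whose entries have sum
      zero; parity tells the second from the third.\<close>
  let ?B1 = "profiles z1 anti3" and ?B2 = "profiles z2 diag3" and ?B3 = "profiles z3 diag3"
  have c1: "6 \<le> card ?B1" using z1(1)[of 0] by (intro card_profiles_anti3[of _ 0]) auto
  have c2: "2 \<le> card ?B2" using z2(2) by (intro card_profiles_diag3[of _ "pi / 2"]) auto
  have c3: "2 \<le> card ?B3" using z3(2)[of 0] by (intro card_profiles_diag3[of _ 0]) auto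
  have diag: "u (- t) $ 1 = (z (- t) / z t) * u t $ 1 \<and> u t $ 1 \<noteq> 0" if "u \<in> profiles z diag3" "z t \<noteq> 0" for z u t
    using that by (auto simp: profiles_def)
  have equal_entries: "u t $ i = u t $ 1" if "u \<in> profiles z diag3" for z u t i
    using that by (auto simp: profiles_def)
  have "?B2 \<inter> ?B3 = {}"
  proof (intro equals0I)
    fix u assume "u \<in> ?B2 \<inter> ?B3"
    then have "u (- (pi / 2)) $ 1 = - u (pi / 2) $ 1" "u (- (pi / 2)) $ 1 = u (pi / 2) $ 1" "u (pi / 2) $ 1 \<noteq> 0"
      using diag[of u z2 "pi / 2"] diag[of u z3 "pi / 2"] z2(1)[of "pi / 2"] z2(2) z3(1)[of "pi / 2"] z3(2)[of "pi / 2"] by auto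
    then show False by simp
  qed
  moreover have "?B1 \<inter> (?B2 \<union> ?B3) = {}"
  proof (intro equals0I)
    fix u assume u: "u \<in> ?B1 \<inter> (?B2 \<union> ?B3)"
    then obtain s \<sigma> where s: "u = (\<lambda>t. z1 t *\<^sub>R (s *\<^sub>R perm_vec \<sigma> anti3))" "bij \<sigma>"
      by (auto simp: profiles_def)
    have "(\<Sum>i\<in>UNIV. anti3 $ \<sigma> i) = (\<Sum>i\<in>UNIV. anti3 $ i)"
      by (rule sum.reindex_bij_betw[OF s(2)])
    then have "(\<Sum>i\<in>UNIV. u (pi / 2) $ i) = 0"
      by (simp add: s perm_vec_def sum_distrib_left[symmetric]) (simp add: sum_3)
    moreover have "u (pi / 2) $ i = u (pi / 2) $ 1 \<and> u (pi / 2) $ 1 \<noteq> 0" for i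
      using u diag[of u z2 "pi / 2"] diag[of u z3 "pi / 2"] z2(2) z3(2)[of "pi / 2"]
        equal_entries[of u z2 "pi / 2" i] equal_entries[of u z3 "pi / 2" i] by auto
    note entries = this[of 2] this[of 3]
    ultimately show False using entries by (simp add: sum_3)
  qed
  ultimately have "card (?B1 \<union> (?B2 \<union> ?B3)) = card ?B1 + (card ?B2 + card ?B3)"
    by (simp add: card_Un_disjoint finite_profiles)
  then have "\<exists>S \<subseteq> solutions f. finite S \<and> card S \<ge> 10"
    using c1 c2 c3 z1 z2 z3 by (intro exI[of _ "?B1 \<union> (?B2 \<union> ?B3)"]) (auto simp: finite_profiles)
  then show ?thesis using c1 c2 c3 z1 z2 z3 by blast
qed

end
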